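(* Let $m\ge 1$ be an integer and let $\alpha>m-1$, $\beta>0$ be real numbers with $\alpha+1-m-\beta\notin\{0,1,\dots,m-1\}$. Then there is $n_0$ such that for all $n\ge n_0$ the set $\{x_1,\dots,x_n\}$ of the regular zeros (the zeros in $(-1,1)$) of the exceptional Jacobi polynomial $\hat P_{m,m+n}^{(\alpha,\beta)}$ is the unique set of minimal energy with respect to the external field $\left(v_{m,n}^{(\alpha+1,\beta+1)}\right)^{\frac1{2(n-1)}}$ on $(-1,1)$; that is, the function $$T_v(u_1,\dots,u_n)=\prod_{j=1}^n v(u_j)\prod_{1\le i<j\le n}(u_i-u_j)^2,\qquad v=v_{m,n}^{(\alpha+1,\beta+1)},$$ on $(-1,1)^n$ attains its maximum exactly at the points $(u_1,\dots,u_n)$ with $\{u_1,\dots,u_n\}=\{x_1,\dots,x_n\}$.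
   Context: $P_k^{(a,b)}$ denotes the classical Jacobi polynomial with parameters $a,b$ (defined for all real $a,b$ by the usual formula), satisfying $(1-x^2)y''+(b-a-(a+b+2)x)y'+k(k+a+b+1)y=0$. Exceptional Jacobi polynomials of codimension $m\ge1$: let $S(x)=P_m^{(-\alpha-1,\beta-1)}(x)$. $\hat P_{m,m+n}^{(\alpha,\beta)}$ ($n\ge0$) is the real polynomial of degree $m+n$, unique up to a nonzero constant factor (irrelevant here), which satisfies $$y''+\left(\frac{\beta-\alpha-(\alpha+\beta+2)x}{1-x^2}-\frac{2S'(x)}{S(x)}\right)y'+\left(\frac{m(\alpha-\beta-m+1)+n(n+\alpha+\beta+1)}{1-x^2}-\frac{\beta}{1+x}\frac{2S'(x)}{S(x)}\right)y=0 .$$ These polynomials are orthogonal on $(-1,1)$ with respect to $(1-x)^\alpha(1+x)^\beta/S(x)^2$. It is known that, under the hypotheses on $\alpha,\beta,m$ in the statement, $S$ has degree $m$ and no zeros in $[-1,1]$, and $\hat P_{m,m+n}^{(\alpha,\beta)}$ has exactly $n$ zeros in $(-1,1)$, all simple (regular zeros), and $m$ zeros (counted with multiplicity, possibly complex) outside $[-1,1]$ (exceptional zeros); as $n\to\infty$ the exceptional zeros approach the zeros of $S$. Write $\hat P_{m,m+n}^{(\alpha,\beta)}=P_{m,n}q_{m,n}$, where $q_{m,n}$ is a real polynomial of degree $n$ whose zeros are the regular zeros and $P_{m,n}$ is a real polynomial of degree $m$ whose zeros are the exceptional zeros. Put $$v_{m,n}^{(\alpha+1,\beta+1)}(x)=\frac{(1-x)^{\alpha+1}(1+x)^{\beta+1}P_{m,n}(x)^2}{S(x)^2},\qquad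 x\in(-1,1).$$ *)

theory Defs
  imports "HOL-Analysis.Analysis" "HOL-Computational_Algebra.Computational_Algebra"
begin

(* The formula sum_s (k+a choose k-s) (k+b choose s) ((x-1)/2)^s ((x+1)/2)^(k-s), which
   is meaningful for all real a, b; for some (a, b) the degree is smaller than k. *)
definition jacobi_poly :: "nat \<Rightarrow> real \<Rightarrow> real \<Rightarrow> real poly" where
  "jacobi_poly k a b =
     (\<Sum>s\<le>k. smult (((real k + a) gchoose (k - s)) * ((real k + b) gchoose s))
              ([:- 1 / 2, 1 / 2:] ^ s * [:1 / 2, 1 / 2:] ^ (k - s)))"

definition xjacobi_S :: "nat \<Rightarrow> real \<Rightarrow> real \<Rightarrow> real poly" where
  "xjacobi_S m \<alpha> \<beta> = jacobi_poly m (- \<alpha> - 1) (\<beta> - 1)"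

(* A predicate, because the exceptional Jacobi polynomial is determined by its degree and
   the differential equation only up to a nonzero constant factor. The equation is an
   identity of rational functions and is required wherever its coefficients are defined. *)
definition exceptional_jacobi :: "nat \<Rightarrow> nat \<Rightarrow> real \<Rightarrow> real \<Rightarrow> real poly \<Rightarrow> bool" where
  "exceptional_jacobi m n \<alpha> \<beta> p \<longleftrightarrow>
     degree p = m + n \<and>
     (\<forall>x. x \<noteq> 1 \<longrightarrow> x \<noteq> - 1 \<longrightarrow> poly (xjacobi_S m \<alpha> \<beta>) x \<noteq> 0 \<longrightarrow>
        (let S = poly (xjacobi_S m \<alpha> \<beta>) x;
             S' = poly (pderiv (xjacobi_S m \<alpha> \<beta>)) x
         in poly (pderiv (pderiv p)) x
            + ((\<beta> - \<alpha> - (\<alpha> + \<beta> + 2) * x) / (1 - x\<^sup>2) - 2 * S' / S) * poly (pderiv p) x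
            + ((real m * (\<alpha> - \<beta> - real m + 1) + real n * (real n + \<alpha> + \<beta> + 1)) / (1 - x\<^sup>2)
               - \<beta> / (1 + x) * (2 * S' / S)) * poly p x = 0))"

definition regular_zeros :: "real poly \<Rightarrow> real set" where
  "regular_zeros p = {x \<in> {-1<..<1}. poly p x = 0}"

(* The factor q of p = P * q carrying the zeros in (-1,1), with multiplicity and normalised
   to be monic; the complementary factor P carries all other complex zeros. Rescaling P only
   multiplies the weight below by a positive constant. *)
definition regular_factor :: "real poly \<Rightarrow> real poly" where
  "regular_factor p = (\<Prod>x\<in>regular_zeros p. [:- x, 1:] ^ order x p)"

definition exceptional_factor :: "real poly \<Rightarrow> real poly" where
  "exceptional_factor p = p div regular_factor p"

lemma regular_factor_dvd:
  assumes "p \<noteq> 0"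
  shows "regular_factor p dvd p"
proof -
  have fin: "finite (regular_zeros p)"
    unfolding regular_zeros_def using poly_roots_finite[OF assms] by (rule rev_finite_subset) auto
  have "(\<Prod>x\<in>A. [:- x, 1:] ^ order x p) dvd p" if "finite A" for A
    using that
  proof (induction A rule: finite_induct)
    case (insert a A)
    define Q where "Q = (\<Prod>x\<in>A. [:- x, 1:] ^ order x p)"
    have "Q dvd p" using insert.IH unfolding Q_def .
    then obtain r where r: "p = Q * r" by (rule dvdE)
    have "poly Q a \<noteq> 0" using insert.hyps unfolding Q_def by (auto simp: poly_prod)
    then have "order a Q = 0" by (rule order_0I)
    then have "order a p = order a r" using assms unfolding r by (simp add: order_mult)
    then have "[:- a, 1:] ^ order a p dvd r" by (simp add: order_1)
    then have "[:- a, 1:] ^ order a p * Q dvd r * Q" by (rule mult_dvd_mono) simp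
    also have "r * Q = p" using r by (simp only: mult.commute)
    finally show ?case unfolding Q_def prod.insert[OF insert.hyps] .
  qed simp
  with fin show ?thesis unfolding regular_factor_def by blast
qed

lemma regular_exceptional_factorization:
  "p \<noteq> 0 \<Longrightarrow> p = exceptional_factor p * regular_factor p"
  using regular_factor_dvd unfolding exceptional_factor_def by simp

(* The weight v with parameters (alpha+1, beta+1). *)
definition xjacobi_weight :: "nat \<Rightarrow> real \<Rightarrow> real \<Rightarrow> real poly \<Rightarrow> real \<Rightarrow> real" where
  "xjacobi_weight m \<alpha> \<beta> p x =
     (1 - x) powr (\<alpha> + 1) * (1 + x) powr (\<beta> + 1) * (poly (exceptional_factor p) x)\<^sup>2
       / (poly (xjacobi_S m \<alpha> \<beta>) x)\<^sup>2"

(* For n > 1 and v > 0 this is the square of the product over i < j of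
   |u_i - u_j| w(u_i) w(u_j), where w = v^(1/(2(n-1))) is the external field; maximising it
   is minimising the energy. Only the values u 1, ..., u n matter. *)
definition energy_T :: "(real \<Rightarrow> real) \<Rightarrow> nat \<Rightarrow> (nat \<Rightarrow> real) \<Rightarrow> real" where
  "energy_T v n u = (\<Prod>j = 1..n. v (u j)) * (\<Prod>j = 1..n. \<Prod>i = 1..<j. (u i - u j)\<^sup>2)"

end

theory Submission
  imports Defs "HOL-Complex_Analysis.Complex_Analysis"
begin

text \<open>
  With \<open>S\<close> as in the definition of the exceptional polynomials and \<open>y\<close> the classical Jacobi polynomial
  of degree \<open>n\<close> with parameters \<open>\<alpha> + 1, \<beta> - 1\<close>, the Darboux transform
  \<open>(1 - x) S y' - ((\<alpha> + 1) S + (1 - x) S') y\<close> solves the exceptional equation; a Wronskian argument at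
  the endpoint \<open>1\<close> shows that every polynomial solution is a multiple of it. Up to a factor without zeros it
  is the derivative of \<open>(1 - x) powr (\<alpha> + 1) * y / S\<close>, so Rolle's theorem yields \<open>n\<close> zeros in \<open>(-1, 1)\<close>.
  Away from \<open>[-1, 1]\<close> the quotient \<open>y' / y\<close> grows linearly in \<open>n\<close>, so by the maximum modulus principle
  each of the \<open>m\<close> simple zeros of \<open>S\<close> attracts a zero of the exceptional polynomial; these are all
  the exceptional zeros.

  Consequently the logarithmic derivative of \<open>P / S\<close>, where \<open>P\<close> is the exceptional factor, has an arbitrarily
  small Lipschitz constant on \<open>(-1, 1)\<close> for large \<open>n\<close>, and the weight \<open>v\<close> is strictly log-concave there. The
  differential equation says that the regular zeros form a critical point of the energy; the tangent
  inequality for \<open>ln v\<close>, together with \<open>ln t \<le> t - 1\<close> for the interaction term, makes this critical point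
  the unique maximizer.
\<close>

section \<open>Jacobi polynomials for arbitrary real parameters\<close>

lemma poly_jacobi_poly:
  "poly (jacobi_poly k a b) x =
     (\<Sum>s\<le>k. ((real k + a) gchoose (k - s)) * ((real k + b) gchoose s) *
            (((x - 1) / 2) ^ s * ((x + 1) / 2) ^ (k - s)))"
  by (simp add: jacobi_poly_def poly_sum diff_divide_distrib add_divide_distrib add.commute)

lemma degree_jacobi_poly_le: "degree (jacobi_poly k a b) \<le> k"
  unfolding jacobi_poly_def
proof (rule degree_sum_le)
  fix s assume "s \<in> {..k}"
  have "degree ([:- 1 / 2, 1 / 2:] ^ s * [:1 / 2, 1 / 2:] ^ (k - s) :: real poly) \<le> 1 * s + 1 * (k - s)"
    by (intro order.trans[OF degree_mult_le] add_mono order.trans[OF degree_power_le]) auto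
  with \<open>s \<in> {..k}\<close>
  show "degree (smult ((real k + a gchoose (k - s)) * (real k + b gchoose s))
      ([:- 1 / 2, 1 / 2:] ^ s * [:1 / 2, 1 / 2:] ^ (k - s))) \<le> k"
    by (intro order.trans[OF degree_smult_le]) simp
qed simp

text \<open>Each product of \<open>s\<close> and \<open>k - s\<close> linear factors has top
  coefficient \<open>1 / 2 ^ k\<close>, so what remains is a Vandermonde convolution. A zero of the
  resulting binomial coefficient is the only way in which the degree can drop below
  \<open>k\<close>.\<close>

lemma coeff_jacobi_poly_top:
  "coeff (jacobi_poly k a b) k = ((2 * real k + a + b) gchoose k) / 2 ^ k"
proof -
  have top: "coeff ([:- 1 / 2, 1 / 2:] ^ s * [:1 / 2, 1 / 2:] ^ (k - s) :: real poly) k = 1 / 2 ^ k"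
    if "s \<le> k" for s
  proof -
    let ?p = "[:- 1 / 2, 1 / 2:] ^ s * [:1 / 2, 1 / 2:] ^ (k - s) :: real poly"
    have "degree ?p = k"
      using that by (subst degree_mult_eq) (auto simp: degree_power_eq)
    moreover have "lead_coeff ?p = (1/2) ^ s * (1/2) ^ (k - s)"
      by (simp add: lead_coeff_mult lead_coeff_power)
    ultimately show ?thesis
      using that by (simp add: power_add[symmetric] power_one_over)
  qed
  have "coeff (jacobi_poly k a b) k =
          (\<Sum>s\<le>k. ((real k + a) gchoose (k - s)) * ((real k + b) gchoose s) / 2 ^ k)"
    unfolding jacobi_poly_def coeff_sum coeff_smult by (intro sum.cong) (use top in simp_all)
  also have "\<dots> = (\<Sum>s\<in>{0..k}. ((real k + b) gchoose s) * ((real k + a) gchoose (k - s))) / 2 ^ k"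
    by (simp add: sum_divide_distrib atMost_atLeast0 mult.commute)
  also have "\<dots> = ((2 * real k + a + b) gchoose k) / 2 ^ k"
    by (subst gbinomial_Vandermonde) (simp add: algebra_simps)
  finally show ?thesis .
qed

lemma gbinomial_Suc_mult: "real (Suc k) * (c gchoose Suc k) = (c - real k) * (c gchoose k)"
  using gbinomial_mult_1[of c k] by (simp add: algebra_simps)

text \<open>Termwise product rule. Where the exponent \<open>s - 1\<close> or
  \<open>k - s - 1\<close> is truncated at 0, the factor \<open>real s\<close> or
  \<open>real (k - s)\<close> vanishes.\<close>

lemma poly_pderiv_jacobi_poly:
  "poly (pderiv (jacobi_poly k a b)) x =
     (\<Sum>s\<le>k. ((real k + a) gchoose (k - s)) * ((real k + b) gchoose s) *
            ((real s * ((x - 1) / 2) ^ (s - 1) * ((x + 1) / 2) ^ (k - s)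
              + real (k - s) * ((x - 1) / 2) ^ s * ((x + 1) / 2) ^ (k - s - 1)) / 2))"
proof -
  define c where "c s = ((real k + a) gchoose (k - s)) * ((real k + b) gchoose s)" for s
  have "((\<lambda>x. \<Sum>s\<le>k. c s * (((x - 1) / 2) ^ s * ((x + 1) / 2) ^ (k - s))) has_real_derivative
     (\<Sum>s\<le>k. c s *
            ((real s * ((x - 1) / 2) ^ (s - 1) * ((x + 1) / 2) ^ (k - s)
              + real (k - s) * ((x - 1) / 2) ^ s * ((x + 1) / 2) ^ (k - s - 1)) / 2))) (at x)"
  proof (intro DERIV_sum, goal_cases)
    case (1 s)
    have u: "((\<lambda>x. (x - 1) / 2) has_real_derivative 1 / 2) (at x)"
      and w: "((\<lambda>x. (x + 1) / 2) has_real_derivative 1 / 2) (at x)"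
      by (auto intro!: derivative_eq_intros)
    show ?case
      by (rule DERIV_cong[OF DERIV_cmult[OF DERIV_mult[OF DERIV_power[OF u] DERIV_power[OF w]]]])
         (simp add: add_divide_distrib ac_simps)
  qed
  also have "(\<lambda>x. \<Sum>s\<le>k. c s * (((x - 1) / 2) ^ s * ((x + 1) / 2) ^ (k - s))) = poly (jacobi_poly k a b)"
    by (simp add: poly_jacobi_poly c_def fun_eq_iff)
  finally show ?thesis
    unfolding c_def by (rule DERIV_unique[OF poly_DERIV])
qed

text \<open>Differentiation gives two sums. After an index shift, \<open>gbinomial_Suc_mult\<close>
  brings both to the same products of binomial coefficients, and the factors
  \<open>B - real s\<close> and \<open>A - real (n - s)\<close> add up to a number independent of
  \<open>s\<close>.\<close>

lemma jacobi_poly_lowering: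
  "poly (pderiv (jacobi_poly (Suc n) a b)) x =
     (real (Suc n) + a + b + 1) / 2 * poly (jacobi_poly n (a + 1) (b + 1)) x"
proof -
  define A where "A = real (Suc n) + a"
  define B where "B = real (Suc n) + b"
  \<comment> \<open>One degree less with both parameters raised by one leaves the upper arguments of
    the binomial coefficients unchanged.\<close>
  have AB: "real n + (a + 1) = A" "real n + (b + 1) = B" by (simp_all add: A_def B_def)
  define u where "u = (x - 1) / 2"
  define w where "w = (x + 1) / 2"
  define c where "c s = (A gchoose (Suc n - s)) * (B gchoose s)" for s
  have c1: "real (Suc s) * c (Suc s) = (B - real s) * ((A gchoose (n - s)) * (B gchoose s))" if "s \<le> n" for s
  proof -
    have "real (Suc s) * c (Suc s) = (A gchoose (n - s)) * (real (Suc s) * (B gchoose Suc s))"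
      by (simp only: c_def diff_Suc_Suc ac_simps)
    then show ?thesis unfolding gbinomial_Suc_mult by simp
  qed
  have c2: "real (Suc n - s) * c s = (A - real (n - s)) * ((A gchoose (n - s)) * (B gchoose s))" if "s \<le> n" for s
  proof -
    have "real (Suc n - s) * c s = (real (Suc (n - s)) * (A gchoose Suc (n - s))) * (B gchoose s)"
      using that by (simp only: c_def Suc_diff_le ac_simps)
    then show ?thesis unfolding gbinomial_Suc_mult by simp
  qed
  have alg: "2 * (c * ((s * U * W + t * U' * W') / 2)) = s * c * (U * W) + t * c * (U' * W')"
    for c s t U W U' W' :: real
    by (simp add: field_simps)
  have "2 * poly (pderiv (jacobi_poly (Suc n) a b)) x =
     (\<Sum>s\<le>Suc n. real s * c s * (u ^ (s - 1) * w ^ (Suc n - s)))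
     + (\<Sum>s\<le>Suc n. real (Suc n - s) * c s * (u ^ s * w ^ (Suc n - s - 1)))"
    unfolding poly_pderiv_jacobi_poly sum_distrib_left sum.distrib[symmetric]
      A_def[symmetric] B_def[symmetric] u_def[symmetric] w_def[symmetric] c_def[symmetric]
    by (intro sum.cong refl alg)
  also have "(\<Sum>s\<le>Suc n. real s * c s * (u ^ (s - 1) * w ^ (Suc n - s)))
     = (\<Sum>s\<le>n. real (Suc s) * c (Suc s) * (u ^ s * w ^ (n - s)))"
    by (subst sum.atMost_Suc_shift) simp
  also have "(\<Sum>s\<le>Suc n. real (Suc n - s) * c s * (u ^ s * w ^ (Suc n - s - 1)))
     = (\<Sum>s\<le>n. real (Suc n - s) * c s * (u ^ s * w ^ (n - s)))"
    by simp
  also have "(\<Sum>s\<le>n. real (Suc s) * c (Suc s) * (u ^ s * w ^ (n - s))) +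
      (\<Sum>s\<le>n. real (Suc n - s) * c s * (u ^ s * w ^ (n - s))) =
      (\<Sum>s\<le>n. (A + b + 1) * (((A gchoose (n - s)) * (B gchoose s)) * (u ^ s * w ^ (n - s))))"
    unfolding sum.distrib[symmetric]
  proof (intro sum.cong refl, goal_cases)
    case (1 s)
    then have "s \<le> n" by simp
    show ?case unfolding c1[OF \<open>s \<le> n\<close>] c2[OF \<open>s \<le> n\<close>] using \<open>s \<le> n\<close>
      by (simp add: B_def algebra_simps of_nat_diff)
  qed
  also have "\<dots> = (A + b + 1) * poly (jacobi_poly n (a + 1) (b + 1)) x"
    unfolding poly_jacobi_poly sum_distrib_left AB u_def w_def by simp
  finally show ?thesis by (simp add: A_def)
qed

text \<open>One step of Rodrigues' formula: up to the factor
  \<open>(1 - x) powr a * (1 + x) powr b\<close>, the left-hand side is the derivative of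
  \<open>(1 - x) powr (a + 1) * (1 + x) powr (b + 1)\<close> times the polynomial. It serves both
  the differential equation and the application of Rolle's theorem.\<close>

lemma jacobi_poly_raising:
  "(1 - x\<^sup>2) * poly (pderiv (jacobi_poly n (a + 1) (b + 1))) x
    + ((b + 1) * (1 - x) - (a + 1) * (1 + x)) * poly (jacobi_poly n (a + 1) (b + 1)) x
    = - 2 * real (Suc n) * poly (jacobi_poly (Suc n) a b) x"
proof -
  define A where "A = real (Suc n) + a"
  define B where "B = real (Suc n) + b"
  have AB: "real n + (a + 1) = A" "real n + (b + 1) = B" by (simp_all add: A_def B_def)
  define u where "u = (x - 1) / 2"
  define w where "w = (x + 1) / 2"
  define c where "c s = (A gchoose (Suc n - s)) * (B gchoose s)" for s
  define d where "d s = (A gchoose (n - s)) * (B gchoose s)" for s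
  have c1: "real (Suc s) * c (Suc s) = (real (n - s) + b + 1) * d s" if "s \<le> n" for s
  proof -
    have "real (Suc s) * c (Suc s) = (A gchoose (n - s)) * (real (Suc s) * (B gchoose Suc s))"
      by (simp only: c_def diff_Suc_Suc ac_simps)
    also have "B - real s = real (n - s) + b + 1" using that by (simp add: B_def of_nat_diff)
    then have "(A gchoose (n - s)) * (real (Suc s) * (B gchoose Suc s)) = (real (n - s) + b + 1) * d s"
      unfolding gbinomial_Suc_mult d_def by simp
    finally show ?thesis .
  qed
  have c2: "real (Suc n - s) * c s = (real s + a + 1) * d s" if "s \<le> n" for s
  proof -
    have "real (Suc n - s) * c s = (real (Suc (n - s)) * (A gchoose Suc (n - s))) * (B gchoose s)"
      using that by (simp only: c_def Suc_diff_le ac_simps)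
    also have "A - real (n - s) = real s + a + 1" using that by (simp add: A_def of_nat_diff)
    then have "(real (Suc (n - s)) * (A gchoose Suc (n - s))) * (B gchoose s) = (real s + a + 1) * d s"
      unfolding gbinomial_Suc_mult d_def by simp
    finally show ?thesis .
  qed
  have 1: "1 - x\<^sup>2 = - 4 * u * w" "1 - x = - 2 * u" "1 + x = 2 * w"
    by (simp_all add: u_def w_def power2_eq_square field_simps)
  \<comment> \<open>The factor \<open>u * w\<close> coming from \<open>1 - x\<^sup>2\<close>
    restores the exponents that differentiation lowered.\<close>
  have mid: "u * w * (real s * u ^ (s - 1) * w ^ (n - s) + real (n - s) * u ^ s * w ^ (n - s - 1))
    = real s * (u ^ s * w ^ (Suc n - s)) + real (n - s) * (u ^ Suc s * w ^ (n - s))" if "s \<le> n" for s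
  proof -
    have 1: "u * (real s * u ^ (s - 1)) = real s * u ^ s" by (cases s) auto
    have 2: "w * (real (n - s) * w ^ (n - s - 1)) = real (n - s) * w ^ (n - s)"
      by (cases "n - s") auto
    have 3: "w ^ (Suc n - s) = w * w ^ (n - s)" using that by (simp add: Suc_diff_le)
    have 4: "u * w * (real s * u ^ (s - 1) * w ^ (n - s) + real (n - s) * u ^ s * w ^ (n - s - 1))
      = (u * (real s * u ^ (s - 1))) * (w * w ^ (n - s)) + u * u ^ s * (w * (real (n - s) * w ^ (n - s - 1)))"
      by (simp only: distrib_left ac_simps)
    show ?thesis unfolding 4 1 2 3 by simp
  qed
  have alg: "- 4 * u * w * (d * ((s * U * W + t * U' * W') / 2))
       + ((b + 1) * (- 2 * u) - (a + 1) * (2 * w)) * (d * (X * Y))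
     = - 2 * d * (u * w * (s * U * W + t * U' * W') + ((b + 1) * u + (a + 1) * w) * (X * Y))"
    for d s t U W U' W' X Y :: real
    by (simp add: field_simps)
  have "(1 - x\<^sup>2) * poly (pderiv (jacobi_poly n (a + 1) (b + 1))) x
    + ((b + 1) * (1 - x) - (a + 1) * (1 + x)) * poly (jacobi_poly n (a + 1) (b + 1)) x
    = (\<Sum>s\<le>n. - 2 * d s * (u * w * (real s * u ^ (s - 1) * w ^ (n - s) + real (n - s) * u ^ s * w ^ (n - s - 1))
         + ((b + 1) * u + (a + 1) * w) * (u ^ s * w ^ (n - s))))"
    unfolding 1 poly_pderiv_jacobi_poly poly_jacobi_poly sum_distrib_left sum.distrib[symmetric] AB
      u_def[symmetric] w_def[symmetric] d_def[symmetric]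
    by (intro sum.cong refl alg)
  also have "\<dots> = (\<Sum>s\<le>n. - 2 * (((real s + a + 1) * d s) * (u ^ s * w ^ (Suc n - s))
                + ((real (n - s) + b + 1) * d s) * (u ^ Suc s * w ^ (n - s))))"
  proof (intro sum.cong refl, goal_cases)
    case (1 s)
    then have "s \<le> n" by simp
    then have "w ^ (Suc n - s) = w * w ^ (n - s)" by (simp add: Suc_diff_le)
    then show ?case unfolding mid[OF \<open>s \<le> n\<close>] by (simp add: algebra_simps)
  qed
  also have "\<dots> = (\<Sum>s\<le>n. - 2 * ((real (Suc n - s) * c s) * (u ^ s * w ^ (Suc n - s))
                + (real (Suc s) * c (Suc s)) * (u ^ Suc s * w ^ (n - s))))"
    by (intro sum.cong refl) (simp only: c1 c2 atMost_iff)
  also have "\<dots> = - 2 * ((\<Sum>s\<le>n. (real (Suc n - s) * c s) * (u ^ s * w ^ (Suc n - s)))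
                + (\<Sum>s\<le>n. (real (Suc s) * c (Suc s)) * (u ^ Suc s * w ^ (Suc n - Suc s))))"
    unfolding sum.distrib[symmetric] sum_distrib_left by simp
  also have "(\<Sum>s\<le>n. (real (Suc n - s) * c s) * (u ^ s * w ^ (Suc n - s)))
     = (\<Sum>s\<le>Suc n. (real (Suc n - s) * c s) * (u ^ s * w ^ (Suc n - s)))"
    by simp
  also have "(\<Sum>s\<le>n. (real (Suc s) * c (Suc s)) * (u ^ Suc s * w ^ (Suc n - Suc s)))
     = (\<Sum>s\<le>Suc n. (real s * c s) * (u ^ s * w ^ (Suc n - s)))"
    by (subst sum.atMost_Suc_shift) simp
  \<comment> \<open>The factors \<open>Suc n - s\<close> and \<open>s\<close> add up to
    \<open>Suc n\<close>, which leaves the defining sum of degree \<open>Suc n\<close>.\<close>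
  also have "- 2 * ((\<Sum>s\<le>Suc n. (real (Suc n - s) * c s) * (u ^ s * w ^ (Suc n - s))) +
      (\<Sum>s\<le>Suc n. (real s * c s) * (u ^ s * w ^ (Suc n - s))))
      = (\<Sum>s\<le>Suc n. - 2 * real (Suc n) * (c s * (u ^ s * w ^ (Suc n - s))))"
    unfolding sum.distrib[symmetric] sum_distrib_left
    by (intro sum.cong refl) (simp add: algebra_simps of_nat_diff)
  also have "\<dots> = - 2 * real (Suc n) * poly (jacobi_poly (Suc n) a b) x"
    unfolding poly_jacobi_poly sum_distrib_left A_def B_def u_def w_def c_def by simp
  finally show ?thesis .
qed

text \<open>Lowering followed by raising returns to the same polynomial up to a constant; degree 0,
  where nothing can be lowered, is separate.\<close>

lemma jacobi_poly_ode:
  "(1 - x\<^sup>2) * poly (pderiv (pderiv (jacobi_poly k a b))) x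
     + (b - a - (a + b + 2) * x) * poly (pderiv (jacobi_poly k a b)) x
     + real k * (real k + a + b + 1) * poly (jacobi_poly k a b) x = 0"
proof (cases k)
  case 0
  have "degree (jacobi_poly 0 a b) = 0" using degree_jacobi_poly_le[of 0] by simp
  then have "pderiv (jacobi_poly 0 a b) = 0" using pderiv_eq_0_iff by blast
  with 0 show ?thesis by simp
next
  case (Suc n)
  define C where "C = (real (Suc n) + a + b + 1) / 2"
  define Q where "Q = jacobi_poly n (a + 1) (b + 1)"
  have *: "pderiv (jacobi_poly (Suc n) a b) = smult C Q"
    by (intro poly_ext) (simp add: jacobi_poly_lowering C_def Q_def)
  have "(1 - x\<^sup>2) * poly (pderiv Q) x + ((b + 1) * (1 - x) - (a + 1) * (1 + x)) * poly Q x
    = - 2 * real (Suc n) * poly (jacobi_poly (Suc n) a b) x"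
    unfolding Q_def by (rule jacobi_poly_raising)
  then have "C * ((1 - x\<^sup>2) * poly (pderiv Q) x + ((b + 1) * (1 - x) - (a + 1) * (1 + x)) * poly Q x)
    = C * (- 2 * real (Suc n) * poly (jacobi_poly (Suc n) a b) x)" by (rule arg_cong)
  moreover have "C * (- 2 * real (Suc n) * poly (jacobi_poly (Suc n) a b) x)
     = - (real k * (real k + a + b + 1) * poly (jacobi_poly k a b) x)"
  proof -
    have "real (Suc n) + a + b + 1 = 2 * C" by (simp add: C_def)
    then show ?thesis unfolding Suc by (simp only:) (simp add: algebra_simps)
  qed
  ultimately show ?thesis unfolding Suc * pderiv_smult poly_smult
    by (simp add: algebra_simps)
qed

section \<open>The algebraic identity behind the Darboux transform\<close>

text \<open>The letters stand for values of \<open>S\<close>, \<open>y\<close> and their derivatives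
  at one point, and \<open>p\<close>, \<open>p1\<close>, \<open>p2\<close> for the Darboux transform
  and its first two derivatives. \<open>E1'\<close> and \<open>E2'\<close> are the differentiated
  equations of \<open>S\<close> and \<open>y\<close>.\<close>

lemma darboux_ode_identity:
  fixes x S S1 S2 S3 y y1 y2 y3 \<alpha> \<beta> M N :: real
  assumes E1: "(1 - x\<^sup>2) * S2 + (\<alpha> + \<beta> - (\<beta> - \<alpha>) * x) * S1 + M * S = 0"
    and E1': "(1 - x\<^sup>2) * S3 - 2 * x * S2 + (\<alpha> + \<beta> - (\<beta> - \<alpha>) * x) * S2 - (\<beta> - \<alpha>) * S1 + M * S1 = 0"
    and E2: "(1 - x\<^sup>2) * y2 + (\<beta> - \<alpha> - 2 - (\<alpha> + \<beta> + 2) * x) * y1 + N * y = 0"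
    and E2': "(1 - x\<^sup>2) * y3 - 2 * x * y2 + (\<beta> - \<alpha> - 2 - (\<alpha> + \<beta> + 2) * x) * y2
                - (\<alpha> + \<beta> + 2) * y1 + N * y1 = 0"
  defines "p \<equiv> (1 - x) * S * y1 - ((\<alpha> + 1) * S + (1 - x) * S1) * y"
    and "p1 \<equiv> (1 - x) * S * y2 - (1 - x) * S2 * y - (\<alpha> + 2) * S * y1 - \<alpha> * S1 * y"
    and "p2 \<equiv> - S * y2 + (1 - x) * S1 * y2 + (1 - x) * S * y3 + S2 * y - (1 - x) * S3 * y
               - (1 - x) * S2 * y1 - (\<alpha> + 2) * S1 * y1 - (\<alpha> + 2) * S * y2 - \<alpha> * S2 * y - \<alpha> * S1 * y1"
  shows "(1 - x\<^sup>2) * S * p2 + ((\<beta> - \<alpha> - (\<alpha> + \<beta> + 2) * x) * S - 2 * (1 - x\<^sup>2) * S1) * p1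
          + ((- M + N) * S - 2 * \<beta> * (1 - x) * S1) * p = 0"
    (is "?G = 0")
proof -
  \<comment> \<open>The exceptional operator is an explicit combination of the four equations: the
    first two multipliers are read off from the terms with \<open>y3\<close> and \<open>S3\<close>,
    the other two from the remaining terms with \<open>y2\<close> and \<open>S2\<close>.\<close>
  have "?G = (1 - x) * S\<^sup>2 * ((1 - x\<^sup>2) * y3 - 2 * x * y2 + (\<beta> - \<alpha> - 2 - (\<alpha> + \<beta> + 2) * x) * y2
                - (\<alpha> + \<beta> + 2) * y1 + N * y1)
     - (1 - x) * S * y * ((1 - x\<^sup>2) * S3 - 2 * x * S2 + (\<alpha> + \<beta> - (\<beta> - \<alpha>) * x) * S2 - (\<beta> - \<alpha>) * S1 + M * S1)
     - ((\<alpha> + 1) * S\<^sup>2 + (1 - x) * S * S1) * ((1 - x\<^sup>2) * y2 + (\<beta> - \<alpha> - 2 - (\<alpha> + \<beta> + 2) * x) * y1 + N * y)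
     + ((\<alpha> + 1) * S * y - (1 - x) * S * y1 + 2 * (1 - x) * S1 * y)
        * ((1 - x\<^sup>2) * S2 + (\<alpha> + \<beta> - (\<beta> - \<alpha>) * x) * S1 + M * S)"
    unfolding p_def p1_def p2_def by (simp add: algebra_simps power2_eq_square)
  also have "\<dots> = 0" unfolding E1 E1' E2 E2' by simp
  finally show ?thesis .
qed

section \<open>Zeros of Jacobi polynomials and the sign of \<open>S\<close> on the interval\<close>

text \<open>Differentiability is asked for only in the open interval, because the applications
  involve real powers of \<open>1 - x\<close> and \<open>1 + x\<close>, for which endpoints count as
  zeros without being points of differentiability in general.\<close>

lemma rolle_finite_set:
  fixes f f' :: "real \<Rightarrow> real"
  assumes "finite A" "A \<subseteq> {a..b}" and cont: "continuous_on {a..b} f"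
    and deriv: "\<And>x. a < x \<Longrightarrow> x < b \<Longrightarrow> (f has_real_derivative f' x) (at x)"
    and "\<And>x. x \<in> A \<Longrightarrow> f x = 0"
  obtains B where "finite B" "B \<subseteq> {a<..<b}" "\<And>x. x \<in> B \<Longrightarrow> f' x = 0" "card A \<le> Suc (card B)"
proof -
  \<comment> \<open>The last conjunct keeps every element of \<open>B\<close> below the maximum of
    \<open>A\<close>, so the zero found between that maximum and the newly inserted point is a new
    one.\<close>
  have "\<exists>B. finite B \<and> B \<subseteq> {a<..<b} \<and> (\<forall>x\<in>B. f' x = 0) \<and> card A \<le> Suc (card B) \<and> (\<forall>x\<in>B. \<exists>z\<in>A. x < z)"
    using assms(1,2,5)
  proof (induction A rule: finite_linorder_max_induct)
    case empty
    then show ?case by (intro exI[of _ "{}"]) auto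
  next
    case (insert c A)
    have "A \<subseteq> {a..b}" "\<And>x. x \<in> A \<Longrightarrow> f x = 0" using insert.prems by simp_all
    from insert.IH[OF this]
    obtain B where B: "finite B" "B \<subseteq> {a<..<b}" "\<forall>x\<in>B. f' x = 0" "card A \<le> Suc (card B)"
      "\<forall>x\<in>B. \<exists>z\<in>A. x < z" by blast
    show ?case
    proof (cases "A = {}")
      case True
      then show ?thesis by (intro exI[of _ "{}"]) auto
    next
      case False
      define d where "d = Max A"
      have d: "d \<in> A" "\<And>z. z \<in> A \<Longrightarrow> z \<le> d" using False insert.hyps by (auto simp: d_def)
      have dc: "a \<le> d" "d < c" "c \<le> b" using d insert.hyps insert.prems by auto
      have "\<exists>\<xi>. d < \<xi> \<and> \<xi> < c \<and> (\<lambda>h. h * f' \<xi>) = (\<lambda>v. 0)"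
      proof (rule Rolle_deriv[OF \<open>d < c\<close>])
        show "f d = f c" using d insert.prems by simp
        show "continuous_on {d..c} f" by (rule continuous_on_subset[OF cont]) (use dc in auto)
        show "(f has_derivative (\<lambda>h. h * f' x)) (at x)" if "d < x" "x < c" for x
          by (rule has_derivative_eq_rhs[OF deriv[unfolded has_field_derivative_def]])
             (use that dc in \<open>auto simp: mult.commute\<close>)
      qed
      then obtain \<xi> where \<xi>: "d < \<xi>" "\<xi> < c" "(\<lambda>h. h * f' \<xi>) = (\<lambda>v. 0)" by blast
      from fun_cong[OF \<xi>(3), of 1] have "f' \<xi> = 0" by simp
      moreover have "\<xi> \<notin> B" using B(5) d(2) \<xi>(1) by force
      moreover have "c \<notin> A" using insert.hyps by auto
      ultimately show ?thesis using B \<xi> dc insert.hyps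
        by (intro exI[of _ "insert \<xi> B"]) auto
    qed
  qed
  then show ?thesis using that by blast
qed

text \<open>With \<open>coeff p (card A)\<close> in place of the leading coefficient the statement
  also covers degrees below \<open>card A\<close>, where it says that \<open>p\<close>
  vanishes.\<close>

lemma poly_eq_prod_roots:
  fixes p :: "'a::field poly"
  assumes "finite A" "\<And>x. x \<in> A \<Longrightarrow> poly p x = 0" "degree p \<le> card A"
  shows "p = smult (coeff p (card A)) (\<Prod>x\<in>A. [:- x, 1:])"
  using assms
proof (induction A arbitrary: p rule: finite_induct)
  case empty
  then have "degree p = 0" by simp
  then obtain c where "p = [:c:]" by (rule degree_eq_zeroE)
  then show ?case by simp
next
  case (insert a A)
  from insert.prems(1)[of a] obtain q where q: "p = [:- a, 1:] * q"
    by (auto simp: poly_eq_0_iff_dvd)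
  have "poly q x = 0" if "x \<in> A" for x
    using insert.prems(1)[of x] insert.hyps that by (auto simp: q)
  moreover have dq: "degree q \<le> card A"
  proof (cases "q = 0")
    case False
    then have "degree p = Suc (degree q)" unfolding q by (subst degree_mult_eq) auto
    then show ?thesis using insert.prems(2) insert.hyps by simp
  qed simp
  ultimately have "q = smult (coeff q (card A)) (\<Prod>x\<in>A. [:- x, 1:])"
    by (rule insert.IH)
  from arg_cong[OF this, of "(*) [:- a, 1:]"]
  have "p = smult (coeff q (card A)) ([:- a, 1:] * (\<Prod>x\<in>A. [:- x, 1:]))"
    unfolding q[symmetric] mult_smult_right .
  moreover have "coeff p (card (insert a A)) = coeff q (card A)"
    using insert.hyps dq by (simp add: q coeff_eq_0)
  ultimately show ?case unfolding prod.insert[OF insert.hyps] by argo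
qed

text \<open>At 1 only the summand \<open>s = 0\<close> survives, and its binomial coefficient is a
  Pochhammer symbol with positive factors.\<close>

lemma jacobi_poly_at_1_pos:
  assumes "a > -1"
  shows "poly (jacobi_poly n a b) 1 > 0"
proof -
  have "poly (jacobi_poly n a b) 1 = (\<Sum>s\<in>{0}. ((real n + a) gchoose (n - s)) * ((real n + b) gchoose s))"
    unfolding poly_jacobi_poly by (intro sum.mono_neutral_cong_right) auto
  also have "\<dots> = pochhammer (a + 1) n / fact n"
    by (simp add: gbinomial_pochhammer')
  also have "\<dots> > 0" using assms by (intro divide_pos_pos pochhammer_pos) auto
  finally show ?thesis .
qed

text \<open>The bracket is the operator of \<open>jacobi_poly_raising\<close>. A general
  \<open>f\<close> allows a second use, with a Wronskian divided by the square of
  \<open>S\<close>.\<close>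

lemma jacobi_weight_deriv:
  assumes "-1 < x" "x < 1" "(f has_real_derivative D) (at x)"
  shows "((\<lambda>x. (1 - x) powr (a + 1) * (1 + x) powr (b + 1) * f x) has_real_derivative
     (1 - x) powr a * (1 + x) powr b *
        ((1 - x\<^sup>2) * D + ((b + 1) * (1 - x) - (a + 1) * (1 + x)) * f x)) (at x)"
proof -
  have p: "(1 - x) powr (a + 1) = (1 - x) * (1 - x) powr a" "(1 + x) powr (b + 1) = (1 + x) * (1 + x) powr b"
    using assms by (simp_all add: powr_add)
  have u: "((\<lambda>x. (1 - x) powr (a + 1)) has_real_derivative (a + 1) * (1 - x) powr (a + 1 - of_nat 1) * (- 1)) (at x)"
    using assms by (intro DERIV_fun_powr) (auto intro!: derivative_eq_intros)
  have w: "((\<lambda>x. (1 + x) powr (b + 1)) has_real_derivative (b + 1) * (1 + x) powr (b + 1 - of_nat 1) * 1) (at x)"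
    using assms by (intro DERIV_fun_powr) (auto intro!: derivative_eq_intros)
  have "((\<lambda>x. (1 - x) powr (a + 1) * (1 + x) powr (b + 1) * f x) has_real_derivative
      ((a + 1) * (1 - x) powr a * (- 1) * (1 + x) powr (b + 1) + (b + 1) * (1 + x) powr b * 1 * (1 - x) powr (a + 1)) * f x
       + D * ((1 - x) powr (a + 1) * (1 + x) powr (b + 1))) (at x)"
    using DERIV_mult[OF DERIV_mult[OF u w] assms(3)] by simp
  then show ?thesis
    by (rule DERIV_cong) (unfold p, simp add: algebra_simps power2_eq_square)
qed

lemma jacobi_weight_cont:
  assumes "a > -1" "b > -1" "continuous_on {-1..1} f"
  shows "continuous_on {-1..1} (\<lambda>x::real. (1 - x) powr (a + 1) * (1 + x) powr (b + 1) * f x)"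
  using assms by (intro continuous_intros continuous_on_powr') auto

text \<open>Induction over the degree with varying parameters: by the raising formula, the
  polynomial of degree \<open>Suc n\<close> is, up to nonvanishing factors, the derivative of the
  weighted polynomial of degree \<open>n\<close> with both parameters increased.\<close>

lemma jacobi_poly_zeros:
  assumes "a > -1" "b > -1"
  obtains Y c where "finite Y" "Y \<subseteq> {-1<..<1}" "card Y = n" "c \<noteq> 0"
    "jacobi_poly n a b = smult c (\<Prod>t\<in>Y. [:- t, 1:])"
proof -
  have "\<exists>Y. finite Y \<and> Y \<subseteq> {-1<..<1} \<and> card Y = n \<and> (\<forall>t\<in>Y. poly (jacobi_poly n a b) t = 0)"
    using assms
  proof (induction n arbitrary: a b)
    case 0
    then show ?case by (intro exI[of _ "{}"]) auto
  next
    case (Suc n)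
    define Q where "Q = jacobi_poly n (a + 1) (b + 1)"
    have "\<exists>Y. finite Y \<and> Y \<subseteq> {-1<..<1} \<and> card Y = n \<and> (\<forall>t\<in>Y. poly Q t = 0)"
      unfolding Q_def by (rule Suc.IH) (use Suc.prems in simp_all)
    then obtain Y where Y: "finite Y" "Y \<subseteq> {-1<..<1}" "card Y = n" "\<forall>t\<in>Y. poly Q t = 0"
      by blast
    define g where "g x = (1 - x\<^sup>2) * poly (pderiv Q) x + ((b + 1) * (1 - x) - (a + 1) * (1 + x)) * poly Q x" for x
    obtain B where B: "finite B" "B \<subseteq> {-1<..<1}"
      "\<And>x. x \<in> B \<Longrightarrow> (1 - x) powr a * (1 + x) powr b * g x = 0"
      \<comment> \<open>The weight adds zeros at both endpoints, so Rolle's theorem turns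
        \<open>n + 2\<close> zeros into \<open>n + 1\<close>.\<close>
      "card (insert (-1) (insert 1 Y)) \<le> Suc (card B)"
    proof (rule rolle_finite_set)
      show "finite (insert (-1) (insert 1 Y))" using Y by simp
      show "insert (-1) (insert 1 Y) \<subseteq> {-1..1::real}" using Y by force
      show "continuous_on {-1..1} (\<lambda>x::real. (1 - x) powr (a + 1) * (1 + x) powr (b + 1) * poly Q x)"
        using Suc.prems by (intro jacobi_weight_cont continuous_intros)
      show "((\<lambda>x. (1 - x) powr (a + 1) * (1 + x) powr (b + 1) * poly Q x) has_real_derivative
          (1 - x) powr a * (1 + x) powr b * g x) (at x)" if "-1 < x" "x < 1" for x
        unfolding g_def using that by (intro jacobi_weight_deriv poly_DERIV)
      show "(1 - x) powr (a + 1) * (1 + x) powr (b + 1) * poly Q x = 0" if "x \<in> insert (-1) (insert 1 Y)" for x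
        using that Suc.prems Y by auto
    qed blast
    have "(1::real) \<notin> Y" "(-1::real) \<notin> insert 1 Y" using Y by auto
    then have "Suc n \<le> card B" using B(4) Y by simp
    then obtain Y' where Y': "Y' \<subseteq> B" "card Y' = Suc n" by (meson obtain_subset_with_card_n)
    have "poly (jacobi_poly (Suc n) a b) x = 0" if "x \<in> Y'" for x
    proof -
      have "x \<in> B" using that Y' by auto
      then have "-1 < x" "x < 1" using B(2) by auto
      then have "g x = 0" using B(3)[OF \<open>x \<in> B\<close>] by simp
      then show ?thesis using jacobi_poly_raising[of x n a b] unfolding g_def Q_def by simp
    qed
    moreover have "finite Y'" using Y' B finite_subset by blast
    ultimately show ?case using Y' B by blast
  qed
  then obtain Y where Y: "finite Y" "Y \<subseteq> {-1<..<1}" "card Y = n" "\<forall>t\<in>Y. poly (jacobi_poly n a b) t = 0" by blast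
  then have "jacobi_poly n a b = smult (coeff (jacobi_poly n a b) n) (\<Prod>t\<in>Y. [:- t, 1:])"
    using poly_eq_prod_roots[of Y "jacobi_poly n a b"] degree_jacobi_poly_le by simp
  moreover from this have "coeff (jacobi_poly n a b) n \<noteq> 0"
    using jacobi_poly_at_1_pos[OF assms(1), of n b] by (metis smult_0_left poly_0 less_irrefl)
  ultimately show ?thesis using that Y by blast
qed

text \<open>All summands have the sign \<open>(-1) ^ m\<close> on the interval: the first binomial
  coefficient contributes \<open>(-1) ^ (m - s)\<close> because \<open>\<alpha> + 1 - m\<close> is
  positive, the power of \<open>x - 1\<close> contributes \<open>(-1) ^ s\<close>, and the second
  binomial coefficient is positive.\<close>

lemma xjacobi_S_sign:
  assumes "\<alpha> > real m - 1" "\<beta> > 0" "-1 \<le> x" "x \<le> 1"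
  shows "(-1) ^ m * poly (xjacobi_S m \<alpha> \<beta>) x > 0"
proof -
  define c where "c s = (-1) ^ (m - s) * ((real m + (- \<alpha> - 1)) gchoose (m - s)) * ((real m + (\<beta> - 1)) gchoose s)" for s
  have c: "c s > 0" if "s \<le> m" for s
  proof -
    have "(-1) ^ (m - s) * ((real m + (- \<alpha> - 1)) gchoose (m - s)) = pochhammer (\<alpha> + 1 - real m) (m - s) / fact (m - s)"
      by (simp add: gbinomial_pochhammer algebra_simps flip: power_mult_distrib power_add)
    also have "\<dots> > 0" using assms by (intro divide_pos_pos pochhammer_pos) auto
    finally have 1: "(-1) ^ (m - s) * ((real m + (- \<alpha> - 1)) gchoose (m - s)) > 0" .
    have "(real m + (\<beta> - 1)) gchoose s = pochhammer (real m - real s + \<beta>) s / fact s"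
      by (simp add: gbinomial_pochhammer' algebra_simps)
    also have "\<dots> > 0" using assms that by (intro divide_pos_pos pochhammer_pos) auto
    finally show ?thesis unfolding c_def by (rule mult_pos_pos[OF 1])
  qed
  have "(-1) ^ m * poly (xjacobi_S m \<alpha> \<beta>) x = (\<Sum>s\<le>m. c s * (((1 - x) / 2) ^ s * ((1 + x) / 2) ^ (m - s)))"
    unfolding xjacobi_S_def poly_jacobi_poly sum_distrib_left
  proof (intro sum.cong refl, goal_cases)
    case (1 s)
    then have "(-1) ^ m = (-1) ^ (m - s) * (-1 :: real) ^ s" by (simp flip: power_add)
    moreover have "((1 - x) / 2) ^ s = (-1) ^ s * ((x - 1) / 2) ^ s"
      by (simp flip: power_mult_distrib add: minus_divide_left)
    ultimately show ?case by (simp add: c_def add.commute)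
  qed
  also have "\<dots> > 0"
  proof (rule sum_pos2)
    \<comment> \<open>The summand \<open>s = m\<close> contains no power of \<open>1 + x\<close> and
      is positive for \<open>x < 1\<close>; at \<open>x = 1\<close> only \<open>s = 0\<close>
      survives.\<close>
    show "(if x = 1 then 0 else m) \<in> {..m}" by simp
    show "0 < c (if x = 1 then 0 else m) * (((1 - x) / 2) ^ (if x = 1 then 0 else m) * ((1 + x) / 2) ^ (m - (if x = 1 then 0 else m)))"
      using c[of "if x = 1 then 0 else m"] assms by auto
  qed (use assms c in \<open>auto intro!: mult_nonneg_nonneg less_imp_le[OF c]\<close>)
  finally show ?thesis .
qed

section \<open>The exceptional polynomials as Darboux transforms\<close>

definition xjacobi :: "nat \<Rightarrow> nat \<Rightarrow> real \<Rightarrow> real \<Rightarrow> real poly" where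
  "xjacobi m n \<alpha> \<beta> =
     (let S = xjacobi_S m \<alpha> \<beta>; y = jacobi_poly n (\<alpha> + 1) (\<beta> - 1)
      in [:1, -1:] * S * pderiv y - (smult (\<alpha> + 1) S + [:1, -1:] * pderiv S) * y)"

text \<open>With the denominators cleared the equation holds at every real \<open>x\<close>,
  including the zeros of \<open>S\<close> and the points 1 and -1.\<close>

lemma xjacobi_ode:
  fixes m n \<alpha> \<beta> x
  defines "S \<equiv> xjacobi_S m \<alpha> \<beta>" and "p \<equiv> xjacobi m n \<alpha> \<beta>"
  shows "(1 - x\<^sup>2) * poly S x * poly (pderiv (pderiv p)) x
       + ((\<beta> - \<alpha> - (\<alpha> + \<beta> + 2) * x) * poly S x - 2 * (1 - x\<^sup>2) * poly (pderiv S) x) * poly (pderiv p) x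
       + ((real m * (\<alpha> - \<beta> - real m + 1) + real n * (real n + \<alpha> + \<beta> + 1)) * poly S x
           - 2 * \<beta> * (1 - x) * poly (pderiv S) x) * poly p x = 0"
proof -
  define y where "y = jacobi_poly n (\<alpha> + 1) (\<beta> - 1)"
  define M where "M = real m * (real m + \<beta> - \<alpha> - 1)"
  define N where "N = real n * (real n + \<alpha> + \<beta> + 1)"
  have E1: "(1 - z\<^sup>2) * poly (pderiv (pderiv S)) z + (\<alpha> + \<beta> - (\<beta> - \<alpha>) * z) * poly (pderiv S) z
      + M * poly S z = 0" for z
    using jacobi_poly_ode[of z m "- \<alpha> - 1" "\<beta> - 1"]
    unfolding S_def xjacobi_S_def M_def by (simp add: algebra_simps)
  have E2: "(1 - z\<^sup>2) * poly (pderiv (pderiv y)) z + (\<beta> - \<alpha> - 2 - (\<alpha> + \<beta> + 2) * z) * poly (pderiv y) z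
      + N * poly y z = 0" for z
    using jacobi_poly_ode[of z n "\<alpha> + 1" "\<beta> - 1"]
    unfolding y_def N_def by (simp add: algebra_simps)
  \<comment> \<open>An equation valid at all points is an identity of polynomials and may be
    differentiated.\<close>
  have deriv_ode: "(1 - x\<^sup>2) * poly (pderiv (pderiv (pderiv f))) x - 2 * x * poly (pderiv (pderiv f)) x
        + (c - d * x) * poly (pderiv (pderiv f)) x - d * poly (pderiv f) x + e * poly (pderiv f) x = 0"
    if *: "\<And>z. (1 - z\<^sup>2) * poly (pderiv (pderiv f)) z + (c - d * z) * poly (pderiv f) z + e * poly f z = 0"
    for f c d e
  proof -
    have "[:1, 0, -1:] * pderiv (pderiv f) + [:c, - d:] * pderiv f + smult e f = 0"
    proof (rule poly_ext)
      fix z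
      show "poly ([:1, 0, -1:] * pderiv (pderiv f) + [:c, - d:] * pderiv f + smult e f) z = poly 0 z"
        using *[of z] by (simp add: algebra_simps power2_eq_square)
    qed
    then have "poly (pderiv ([:1, 0, -1:] * pderiv (pderiv f) + [:c, - d:] * pderiv f + smult e f)) x = 0"
      by simp
    then show ?thesis
      unfolding pderiv_add pderiv_mult pderiv_smult
      by (simp add: pderiv_pCons algebra_simps power2_eq_square)
  qed
  have p: "p = [:1, -1:] * S * pderiv y - (smult (\<alpha> + 1) S + [:1, -1:] * pderiv S) * y"
    unfolding p_def xjacobi_def Let_def S_def y_def ..
  have p0: "poly p x = (1 - x) * poly S x * poly (pderiv y) x
      - ((\<alpha> + 1) * poly S x + (1 - x) * poly (pderiv S) x) * poly y x"
    unfolding p by (simp add: algebra_simps)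
  have p1: "poly (pderiv p) x = (1 - x) * poly S x * poly (pderiv (pderiv y)) x
      - (1 - x) * poly (pderiv (pderiv S)) x * poly y x
      - (\<alpha> + 2) * poly S x * poly (pderiv y) x - \<alpha> * poly (pderiv S) x * poly y x"
    unfolding p by (simp add: pderiv_diff pderiv_minus pderiv_add pderiv_mult pderiv_smult pderiv_pCons algebra_simps)
  have p2: "poly (pderiv (pderiv p)) x = - poly S x * poly (pderiv (pderiv y)) x
      + (1 - x) * poly (pderiv S) x * poly (pderiv (pderiv y)) x
      + (1 - x) * poly S x * poly (pderiv (pderiv (pderiv y))) x
      + poly (pderiv (pderiv S)) x * poly y x
      - (1 - x) * poly (pderiv (pderiv (pderiv S))) x * poly y x
      - (1 - x) * poly (pderiv (pderiv S)) x * poly (pderiv y) x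
      - (\<alpha> + 2) * poly (pderiv S) x * poly (pderiv y) x
      - (\<alpha> + 2) * poly S x * poly (pderiv (pderiv y)) x
      - \<alpha> * poly (pderiv (pderiv S)) x * poly y x - \<alpha> * poly (pderiv S) x * poly (pderiv y) x"
    unfolding p by (simp add: pderiv_diff pderiv_minus pderiv_add pderiv_mult pderiv_smult pderiv_pCons algebra_simps)
  \<comment> \<open>The constant of the exceptional equation is the difference of the eigenvalues
    belonging to \<open>y\<close> and \<open>S\<close>.\<close>
  have MN: "real m * (\<alpha> - \<beta> - real m + 1) + real n * (real n + \<alpha> + \<beta> + 1) = - M + N"
    by (simp add: M_def N_def algebra_simps)
  have E1': "(1 - x\<^sup>2) * poly (pderiv (pderiv (pderiv S))) x - 2 * x * poly (pderiv (pderiv S)) x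
      + (\<alpha> + \<beta> - (\<beta> - \<alpha>) * x) * poly (pderiv (pderiv S)) x - (\<beta> - \<alpha>) * poly (pderiv S) x + M * poly (pderiv S) x = 0"
    by (rule deriv_ode[OF E1])
  have E2': "(1 - x\<^sup>2) * poly (pderiv (pderiv (pderiv y))) x - 2 * x * poly (pderiv (pderiv y)) x
      + (\<beta> - \<alpha> - 2 - (\<alpha> + \<beta> + 2) * x) * poly (pderiv (pderiv y)) x - (\<alpha> + \<beta> + 2) * poly (pderiv y) x + N * poly (pderiv y) x = 0"
    by (rule deriv_ode[OF E2])
  show ?thesis
    unfolding MN p0 p1 p2 by (rule darboux_ode_identity[OF E1 E1' E2 E2'])
qed

text \<open>Brings the defining equation into the form of \<open>xjacobi_ode\<close>, so that both
  solutions can enter one Wronskian.\<close>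

lemma exceptional_jacobi_ode:
  fixes m \<alpha> \<beta>
  defines "S \<equiv> xjacobi_S m \<alpha> \<beta>"
  assumes "exceptional_jacobi m n \<alpha> \<beta> p" "x \<noteq> 1" "x \<noteq> -1" "poly S x \<noteq> 0"
  shows "(1 - x\<^sup>2) * poly S x * poly (pderiv (pderiv p)) x
       + ((\<beta> - \<alpha> - (\<alpha> + \<beta> + 2) * x) * poly S x - 2 * (1 - x\<^sup>2) * poly (pderiv S) x) * poly (pderiv p) x
       + ((real m * (\<alpha> - \<beta> - real m + 1) + real n * (real n + \<alpha> + \<beta> + 1)) * poly S x
           - 2 * \<beta> * (1 - x) * poly (pderiv S) x) * poly p x = 0"
proof -
  have D: "1 - x\<^sup>2 = (1 - x) * (1 + x)" "1 - x \<noteq> 0" "1 + x \<noteq> 0" using assms(3,4)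
    by (auto simp: power2_eq_square algebra_simps)
  have alg: "d * e * s * p2 + (A * s - 2 * (d * e) * s') * p1 + (B * s - 2 * \<beta> * d * s') * p0
     = (d * e * s) * (p2 + (A / (d * e) - 2 * s' / s) * p1 + (B / (d * e) - \<beta> / e * (2 * s' / s)) * p0)"
    if "d \<noteq> 0" "e \<noteq> 0" "s \<noteq> 0" for d e s s' A B p0 p1 p2 :: real
    using that by (simp add: field_simps)
  have "poly (pderiv (pderiv p)) x
            + ((\<beta> - \<alpha> - (\<alpha> + \<beta> + 2) * x) / (1 - x\<^sup>2) - 2 * poly (pderiv S) x / poly S x) * poly (pderiv p) x
            + ((real m * (\<alpha> - \<beta> - real m + 1) + real n * (real n + \<alpha> + \<beta> + 1)) / (1 - x\<^sup>2)
               - \<beta> / (1 + x) * (2 * poly (pderiv S) x / poly S x)) * poly p x = 0"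
    using assms(2-5) unfolding exceptional_jacobi_def Let_def S_def by blast
  then show ?thesis unfolding D(1) alg[OF D(2,3) assms(5)] by simp
qed

section \<open>Real zeros and uniqueness of the polynomial solution\<close>

text \<open>In characteristic 0 a vanishing Wronskian forces equal degrees, by comparison of the top
  coefficients. Subtracting from \<open>q\<close> the multiple of \<open>p\<close> with the same
  leading term preserves the vanishing but lowers the degree, so the difference is 0.\<close>

lemma poly_wronskian_zero_imp_smult:
  fixes p q :: "'a::field_char_0 poly"
  assumes "p \<noteq> 0" "q \<noteq> 0" "p * pderiv q = pderiv p * q"
  obtains k where "k \<noteq> 0" "q = smult k p"
proof -
  have deg: "degree f = degree g" if "f \<noteq> 0" "g \<noteq> 0" "f * pderiv g = pderiv f * g" for f g :: "'a poly"
  proof -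
    have c: "coeff (f * pderiv g) (degree f + degree g - 1) = of_nat (degree g) * (lead_coeff f * lead_coeff g)"
      if "degree g \<noteq> 0" for f g :: "'a poly"
    proof -
      have "degree f + degree g - 1 = degree f + degree (pderiv g)" using that by (simp add: degree_pderiv)
      then have "coeff (f * pderiv g) (degree f + degree g - 1) = lead_coeff f * lead_coeff (pderiv g)"
        by (simp only: coeff_mult_degree_sum)
      also have "lead_coeff (pderiv g) = of_nat (degree g) * lead_coeff g"
        using that by (simp add: degree_pderiv coeff_pderiv del: of_nat_Suc)
      finally show ?thesis by (simp add: ac_simps)
    qed
    show ?thesis
    proof (cases "degree f = 0 \<or> degree g = 0")
      case True
      then have "pderiv f = 0 \<or> pderiv g = 0" by (simp add: pderiv_eq_0_iff)
      then have "pderiv f = 0 \<and> pderiv g = 0" using that by auto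
      then show ?thesis by (simp add: pderiv_eq_0_iff)
    next
      case False
      then have "of_nat (degree g) * (lead_coeff f * lead_coeff g) = of_nat (degree f) * (lead_coeff g * lead_coeff f)"
        using c[of g f] c[of f g] that(3) by (simp add: mult.commute add.commute)
      then have "of_nat (degree g) = (of_nat (degree f) :: 'a)" using that by simp
      then show ?thesis by simp
    qed
  qed
  define k where "k = lead_coeff q / lead_coeff p"
  define r where "r = q - smult k p"
  have dpq: "degree p = degree q" using deg assms by blast
  have "r = 0"
  proof (rule ccontr)
    assume "r \<noteq> 0"
    have "p * pderiv r = pderiv p * r"
      unfolding r_def using assms(3) by (simp add: pderiv_diff pderiv_smult algebra_simps)
    then have dr: "degree p = degree r" using deg assms(1) \<open>r \<noteq> 0\<close> by blast
    have "coeff r (degree p) = 0" using assms(1) by (simp add: r_def k_def dpq[symmetric])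
    then show False using dr \<open>r \<noteq> 0\<close> by simp
  qed
  then have "q = smult k p" by (simp add: r_def)
  moreover have "k \<noteq> 0" using assms by (simp add: k_def)
  ultimately show ?thesis using that by blast
qed

lemma xjacobi_S_nonzero:
  assumes "\<alpha> > real m - 1" "\<beta> > 0" "-1 \<le> x" "x \<le> 1"
  shows "poly (xjacobi_S m \<alpha> \<beta>) x \<noteq> 0"
  using xjacobi_S_sign[OF assms] by auto

text \<open>At 1 only the term without the factor \<open>1 - x\<close> remains, and its three
  factors are nonzero.\<close>

lemma xjacobi_nonzero:
  assumes "\<alpha> > real m - 1" "\<beta> > 0"
  shows "xjacobi m n \<alpha> \<beta> \<noteq> 0"
proof -
  have "poly (xjacobi m n \<alpha> \<beta>) 1
      = - (\<alpha> + 1) * poly (xjacobi_S m \<alpha> \<beta>) 1 * poly (jacobi_poly n (\<alpha> + 1) (\<beta> - 1)) 1"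
    by (simp add: xjacobi_def Let_def algebra_simps)
  moreover have "poly (jacobi_poly n (\<alpha> + 1) (\<beta> - 1)) 1 > 0"
    using assms by (intro jacobi_poly_at_1_pos) simp
  moreover have "\<alpha> + 1 \<noteq> 0" using assms by simp
  ultimately have "poly (xjacobi m n \<alpha> \<beta>) 1 \<noteq> 0"
    using xjacobi_S_nonzero[OF assms, of 1] by simp
  then show ?thesis by force
qed

text \<open>The \<open>n\<close> zeros of \<open>y\<close>, together with the endpoint 1 where
  \<open>(1 - x) powr (\<alpha> + 1)\<close> vanishes, give \<open>n + 1\<close> zeros of the
  function \<open>f\<close>, whose derivative has the Darboux transform as numerator.\<close>

lemma xjacobi_zeros:
  assumes "\<alpha> > real m - 1" "\<beta> > 0"
  obtains B where "finite B" "B \<subseteq> {-1<..<1}" "n \<le> card B" "\<And>x. x \<in> B \<Longrightarrow> poly (xjacobi m n \<alpha> \<beta>) x = 0"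
proof -
  define S where "S = xjacobi_S m \<alpha> \<beta>"
  define y where "y = jacobi_poly n (\<alpha> + 1) (\<beta> - 1)"
  have S: "poly S x \<noteq> 0" if "-1 \<le> x" "x \<le> 1" for x
    unfolding S_def by (rule xjacobi_S_nonzero[OF assms that])
  obtain Y c where Y: "finite Y" "Y \<subseteq> {-1<..<1}" "card Y = n" "y = smult c (\<Prod>t\<in>Y. [:- t, 1:])"
    unfolding y_def by (rule jacobi_poly_zeros[of "\<alpha> + 1" "\<beta> - 1" n]) (use assms in auto)
  have y0: "poly y t = 0" if "t \<in> Y" for t
    using Y(1) that by (auto simp: Y(4) poly_prod)
  define f where "f x = (1 - x) powr (\<alpha> + 1) * (poly y x / poly S x)" for x
  obtain B where B: "finite B" "B \<subseteq> {-1<..<1}"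
      "\<And>x. x \<in> B \<Longrightarrow> (1 - x) powr \<alpha> * (poly (xjacobi m n \<alpha> \<beta>) x / (poly S x)\<^sup>2) = 0"
      "card (insert 1 Y) \<le> Suc (card B)"
  proof (rule rolle_finite_set)
    show "finite (insert 1 Y)" using Y by simp
    show "insert 1 Y \<subseteq> {-1..1::real}" using Y by force
    show "continuous_on {-1..1} f"
      unfolding f_def using assms S by (intro continuous_intros continuous_on_powr') auto
    show "f x = 0" if "x \<in> insert 1 Y" for x
      using that y0 unfolding f_def by auto
    show "(f has_real_derivative (1 - x) powr \<alpha> * (poly (xjacobi m n \<alpha> \<beta>) x / (poly S x)\<^sup>2)) (at x)"
      if x: "-1 < x" "x < 1" for x
    proof -
      have u: "((\<lambda>x. (1 - x) powr (\<alpha> + 1)) has_real_derivative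
                 (\<alpha> + 1) * (1 - x) powr (\<alpha> + 1 - of_nat 1) * (- 1)) (at x)"
        using x by (intro DERIV_fun_powr) (auto intro!: derivative_eq_intros)
      have Sx: "poly S x \<noteq> 0" using S x by simp
      have p: "(1 - x) powr (\<alpha> + 1) = (1 - x) * (1 - x) powr \<alpha>"
        using x by (simp add: powr_add)
      have px: "poly (xjacobi m n \<alpha> \<beta>) x = (1 - x) * poly S x * poly (pderiv y) x
          - ((\<alpha> + 1) * poly S x + (1 - x) * poly (pderiv S) x) * poly y x"
        by (simp add: xjacobi_def Let_def S_def y_def algebra_simps)
      show ?thesis
        unfolding f_def using DERIV_mult[OF u DERIV_divide[OF poly_DERIV poly_DERIV Sx], of y]
        by (rule DERIV_cong) (use Sx in \<open>unfold p px, simp add: field_simps power2_eq_square\<close>)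
    qed
  qed blast
  have "(1::real) \<notin> Y" using Y by auto
  then have "n \<le> card B" using B(4) Y by simp
  moreover have "poly (xjacobi m n \<alpha> \<beta>) x = 0" if "x \<in> B" for x
  proof -
    have "-1 < x" "x < 1" using that B(2) by auto
    then show ?thesis using B(3)[OF that] S[of x] by simp
  qed
  ultimately show ?thesis using that B by blast
qed

text \<open>Abel's identity: both polynomials solve the same second-order equation, so their
  Wronskian times the integrating factor is constant on the interval.\<close>

lemma exceptional_jacobi_unique:
  assumes "\<alpha> > real m - 1" "\<beta> > 0" and p: "exceptional_jacobi m n \<alpha> \<beta> p" "p \<noteq> 0"
  obtains k where "k \<noteq> 0" "xjacobi m n \<alpha> \<beta> = smult k p"
proof -
  define S where "S = xjacobi_S m \<alpha> \<beta>"
  define q where "q = xjacobi m n \<alpha> \<beta>"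
  have S: "poly S x \<noteq> 0" if "-1 \<le> x" "x \<le> 1" for x
    unfolding S_def by (rule xjacobi_S_nonzero[OF assms(1,2) that])
  define W where "W = p * pderiv q - pderiv p * q"
  define G where "G x = (1 - x) powr (\<alpha> + 1) * (1 + x) powr (\<beta> + 1) * (poly W x / (poly S x)\<^sup>2)" for x
  have "(G has_real_derivative 0) (at x)" if x: "-1 < x" "x < 1" for x
  proof -
    have Sx: "poly S x \<noteq> 0" using S x by simp
    define A where "A = \<beta> - \<alpha> - (\<alpha> + \<beta> + 2) * x"
    define p0 where "p0 = poly p x"
    define p1 where "p1 = poly (pderiv p) x"
    define p2 where "p2 = poly (pderiv (pderiv p)) x"
    define q0 where "q0 = poly q x"
    define q1 where "q1 = poly (pderiv q) x"
    define q2 where "q2 = poly (pderiv (pderiv q)) x"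
    define s where "s = poly S x"
    define s1 where "s1 = poly (pderiv S) x"
    define C where "C = (real m * (\<alpha> - \<beta> - real m + 1) + real n * (real n + \<alpha> + \<beta> + 1)) * s - 2 * \<beta> * (1 - x) * s1"
    have P: "(1 - x\<^sup>2) * s * p2 + (A * s - 2 * (1 - x\<^sup>2) * s1) * p1 + C * p0 = 0"
      using exceptional_jacobi_ode[OF p(1), of x] x Sx
      by (simp add: S_def s_def s1_def p0_def p1_def p2_def A_def C_def)
    have Q: "(1 - x\<^sup>2) * s * q2 + (A * s - 2 * (1 - x\<^sup>2) * s1) * q1 + C * q0 = 0"
      using xjacobi_ode[of x m \<alpha> \<beta> n]
      by (simp add: S_def s_def s1_def q0_def q1_def q2_def A_def C_def q_def)
    \<comment> \<open>Cross-multiplication eliminates the zero-order coefficient \<open>C\<close>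
      and leaves a first-order equation for \<open>W\<close>.\<close>
    have "(1 - x\<^sup>2) * s * (p0 * q2 - p2 * q0) + (A * s - 2 * (1 - x\<^sup>2) * s1) * (p0 * q1 - p1 * q0) =
       p0 * ((1 - x\<^sup>2) * s * q2 + (A * s - 2 * (1 - x\<^sup>2) * s1) * q1 + C * q0)
       - q0 * ((1 - x\<^sup>2) * s * p2 + (A * s - 2 * (1 - x\<^sup>2) * s1) * p1 + C * p0)"
      by (simp add: algebra_simps)
    also have "\<dots> = 0" unfolding P Q by simp
    finally have PQ: "(1 - x\<^sup>2) * s * (p0 * q2 - p2 * q0) + (A * s - 2 * (1 - x\<^sup>2) * s1) * (p0 * q1 - p1 * q0) = 0" .
    have W1: "poly (pderiv W) x = p0 * q2 - p2 * q0" "poly W x = p0 * q1 - p1 * q0"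
      unfolding W_def by (simp_all add: pderiv_diff pderiv_mult p0_def p1_def p2_def q0_def q1_def q2_def algebra_simps)
    have "((\<lambda>x. poly W x / (poly S x)\<^sup>2) has_real_derivative
        (poly (pderiv W) x * s\<^sup>2 - poly W x * (2 * s * s1)) / (s\<^sup>2 * s\<^sup>2)) (at x)"
      unfolding s_def s1_def using Sx by (auto intro!: derivative_eq_intros poly_DERIV simp: power2_eq_square)
    from jacobi_weight_deriv[OF x this, of \<alpha> \<beta>]
    have "(G has_real_derivative (1 - x) powr \<alpha> * (1 + x) powr \<beta> *
        ((1 - x\<^sup>2) * ((poly (pderiv W) x * s\<^sup>2 - poly W x * (2 * s * s1)) / (s\<^sup>2 * s\<^sup>2))
         + ((\<beta> + 1) * (1 - x) - (\<alpha> + 1) * (1 + x)) * (poly W x / s\<^sup>2))) (at x)"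
      unfolding G_def s_def .
    moreover have "(1 - x\<^sup>2) * ((poly (pderiv W) x * s\<^sup>2 - poly W x * (2 * s * s1)) / (s\<^sup>2 * s\<^sup>2))
         + ((\<beta> + 1) * (1 - x) - (\<alpha> + 1) * (1 + x)) * (poly W x / s\<^sup>2)
        = ((1 - x\<^sup>2) * s * poly (pderiv W) x + (A * s - 2 * (1 - x\<^sup>2) * s1) * poly W x) / s ^ 3"
    proof -
      have alg: "D * ((w1 * s\<^sup>2 - w * (2 * s * s1)) / (s\<^sup>2 * s\<^sup>2)) + K * (w / s\<^sup>2)
          = (D * s * w1 + (K * s - 2 * D * s1) * w) / s ^ 3" if "s \<noteq> 0" for D K w w1 s s1 :: real
        using that by (simp add: field_simps power2_eq_square power3_eq_cube)
      have K: "(\<beta> + 1) * (1 - x) - (\<alpha> + 1) * (1 + x) = A" by (simp add: A_def algebra_simps)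
      show ?thesis unfolding K by (rule alg) (use Sx in \<open>simp add: s_def\<close>)
    qed
    ultimately show ?thesis unfolding W1 PQ by simp
  qed
  moreover have "continuous_on {-1..1} G"
    unfolding G_def using assms S by (intro jacobi_weight_cont continuous_intros) auto
  ultimately have G: "G x = G (-1)" if "-1 \<le> x" "x \<le> 1" for x
    using DERIV_isconst2[of "-1" 1 G x] that by simp
  \<comment> \<open>The constant value is 0 because \<open>(1 + x) powr (\<beta> + 1)\<close>
    vanishes at -1.\<close>
  have "poly W x = 0" if "-1 < x" "x < 1" for x
    using G[of x] that S[of x] assms by (auto simp: G_def)
  then have "{-1<..<1} \<subseteq> {x. poly W x = 0}" by auto
  from infinite_super[OF this infinite_Ioo] have "infinite {x. poly W x = 0}" by simp
  then have "W = 0" using poly_roots_finite by blast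
  then have "p * pderiv q = pderiv p * q" by (simp add: W_def)
  then show ?thesis
    using poly_wronskian_zero_imp_smult[OF p(2) xjacobi_nonzero[OF assms(1,2), of n]] that
    unfolding q_def by metis
qed

section \<open>Attraction of complex zeros\<close>

lemma poly_pderiv_prod_roots:
  fixes z :: "'a::field"
  assumes "finite A" "z \<notin> A"
  shows "poly (pderiv (\<Prod>x\<in>A. [:- x, 1:])) z = poly (\<Prod>x\<in>A. [:- x, 1:]) z * (\<Sum>x\<in>A. 1 / (z - x))"
  using assms
proof (induction A rule: finite_induct)
  case (insert x A)
  then show ?case
    by (simp add: pderiv_mult pderiv_pCons field_simps del: mult_pCons_left)
qed simp

text \<open>The points \<open>t - z\<close> lie in a common half-plane away from 0. Inversion
  followed by conjugation preserves directions, so the summands cannot cancel, and the component of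
  the sum along \<open>cnj a\<close> already grows like \<open>card A\<close>.\<close>

lemma norm_sum_inverse_ge:
  fixes a z :: complex
  assumes "finite A" "A \<noteq> {}" "\<eta> > 0" "\<And>t. t \<in> A \<Longrightarrow> inner a (t - z) \<ge> \<eta>" "\<And>t. t \<in> A \<Longrightarrow> norm (t - z) \<le> M"
  shows "norm (\<Sum>t\<in>A. 1 / (z - t)) \<ge> real (card A) * (\<eta> / (M\<^sup>2 * norm a))"
proof -
  have M: "M > 0"
  proof -
    obtain t where "t \<in> A" using assms(2) by blast
    then have "t \<noteq> z" using assms(3,4) by force
    then show ?thesis using assms(5)[OF \<open>t \<in> A\<close>] by (smt (verit) zero_less_norm_iff right_minus_eq)
  qed
  have a: "norm a > 0" using assms(2-4) by force
  have "inner (cnj a) (1 / (z - t)) \<le> - (\<eta> / M\<^sup>2)" if "t \<in> A" for t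
  proof -
    have "t \<noteq> z" using assms(3) assms(4)[OF that] by force
    then have pos: "norm (z - t) > 0" by simp
    have "1 / (z - t) = cnj (z - t) / complex_of_real ((norm (z - t))\<^sup>2)"
      using pos by (simp add: complex_div_cnj[of 1])
    then have "1 / (z - t) = (1 / (norm (z - t))\<^sup>2) *\<^sub>R cnj (z - t)"
      by (simp add: scaleR_conv_of_real divide_inverse mult.commute)
    moreover have "inner (cnj a) (cnj (z - t)) = - inner a (t - z)"
      by (simp add: inner_complex_def algebra_simps)
    ultimately have "inner (cnj a) (1 / (z - t)) = - (inner a (t - z) / (norm (z - t))\<^sup>2)"
      by (simp only: inner_scaleR_right) simp
    moreover have "\<eta> / M\<^sup>2 \<le> inner a (t - z) / (norm (z - t))\<^sup>2"
    proof (rule frac_le)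
      show "(norm (z - t))\<^sup>2 \<le> M\<^sup>2" using assms(5)[OF that] by (simp add: power_mono norm_minus_commute)
    qed (use assms(3) assms(4)[OF that] pos in auto)
    ultimately show ?thesis by simp
  qed
  then have "(\<Sum>t\<in>A. inner (cnj a) (1 / (z - t))) \<le> (\<Sum>t\<in>A. - (\<eta> / M\<^sup>2))" by (rule sum_mono)
  then have "real (card A) * (\<eta> / M\<^sup>2) \<le> - inner (cnj a) (\<Sum>t\<in>A. 1 / (z - t))"
    by (simp add: inner_sum_right)
  also have "\<dots> \<le> norm (cnj a) * norm (\<Sum>t\<in>A. 1 / (z - t))"
    by (rule order.trans[OF _ Cauchy_Schwarz_ineq2]) simp
  finally show ?thesis using a M by (simp add: field_simps)
qed

text \<open>For large \<open>n\<close> the term with the derivative of \<open>y\<close> dominates on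
  a small circle around \<open>\<zeta>\<close>, but vanishes at \<open>\<zeta>\<close> itself.
  Without a zero of the combination \<open>p\<close> in the disc, the quotient of the derivative of
  \<open>y\<close> by \<open>p\<close> would be holomorphic, bounded on the circle and much larger
  at the centre. The bound on \<open>n\<close> is uniform in the root set \<open>A\<close>, which
  varies with \<open>n\<close> in the application.\<close>

lemma eventually_zero_near:
  fixes T R :: "complex poly"
  assumes "T \<noteq> 0" "poly T \<zeta> = 0" "\<zeta> \<notin> complex_of_real ` {-1..1}" "\<rho> > 0"
  shows "\<forall>\<^sub>F n in sequentially. \<forall>A c. A \<subseteq> complex_of_real ` {-1..1} \<longrightarrow> finite A \<longrightarrow> card A = n \<longrightarrow> c \<noteq> 0 \<longrightarrow>
    (\<exists>\<xi>. dist \<xi> \<zeta> < \<rho> \<and>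
      poly (T * pderiv (smult c (\<Prod>t\<in>A. [:- t, 1:])) - R * smult c (\<Prod>t\<in>A. [:- t, 1:])) \<xi> = 0)"
proof -
  define K where "K = complex_of_real ` {-1..1}"
  have "convex K" unfolding K_def by (intro convex_linear_image bounded_linear.linear bounded_linear_of_real) simp
  moreover have "closed K" unfolding K_def
    by (intro compact_imp_closed compact_continuous_image continuous_intros) simp
  ultimately obtain a b where ab: "inner a \<zeta> < b" "\<And>x. x \<in> K \<Longrightarrow> inner a x > b"
    using separating_hyperplane_closed_point[of K \<zeta>] assms(3) unfolding K_def by blast
  define \<eta> where "\<eta> = (b - inner a \<zeta>) / 2"
  have \<eta>: "\<eta> > 0" using ab by (simp add: \<eta>_def)
  obtain d where d: "d > 0" "\<And>x. poly T x = 0 \<Longrightarrow> x \<noteq> \<zeta> \<Longrightarrow> d \<le> dist \<zeta> x"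
    using finite_set_avoid[OF poly_roots_finite[OF assms(1)], of \<zeta>] by blast
  \<comment> \<open>The three bounds keep the disc inside the prescribed neighbourhood, exclude
    other zeros of \<open>T\<close>, and use up at most half of the separation from
    \<open>K\<close>.\<close>
  define r where "r = Min {\<rho> / 2, d / 2, \<eta> / (norm a + 1)}"
  have na: "norm a + 1 > 0" by (smt (verit) norm_ge_zero)
  have r: "r > 0" "r < \<rho>" "r < d" "r \<le> \<eta> / (norm a + 1)"
    using assms(4) d \<eta> na unfolding r_def by auto
  have sep: "inner a (t - z) \<ge> \<eta>" if "t \<in> K" "z \<in> cball \<zeta> r" for t z
  proof -
    have "norm (z - \<zeta>) \<le> r" using that(2) by (simp add: dist_norm norm_minus_commute)
    then have "norm a * norm (z - \<zeta>) \<le> (norm a + 1) * r" by (intro mult_mono) auto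
    also have "\<dots> \<le> \<eta>" using r(4) na by (simp add: field_simps)
    finally have "inner a (z - \<zeta>) \<le> \<eta>" using Cauchy_Schwarz_ineq2[of a "z - \<zeta>"] by linarith
    then show ?thesis using ab(2)[OF that(1)] by (simp add: \<eta>_def inner_diff_right field_simps)
  qed
  define M where "M = norm \<zeta> + r + 1"
  have bnd: "norm (t - z) \<le> M" if "t \<in> K" "z \<in> cball \<zeta> r" for t z
  proof -
    have "norm t \<le> 1" using that(1) by (auto simp: K_def)
    moreover have "norm z \<le> norm \<zeta> + r" using that(2) norm_triangle_ineq2[of z \<zeta>] by (simp add: dist_norm norm_minus_commute)
    ultimately show ?thesis unfolding M_def using norm_triangle_ineq4[of t z] by linarith
  qed
  have a: "norm a > 0" using ab(1) ab(2)[of 1] by (force simp: K_def)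
  have M: "M > 0" unfolding M_def using r(1) norm_ge_zero[of \<zeta>] by linarith
  \<comment> \<open>Each root contributes at least this much to the modulus of the logarithmic
    derivative of \<open>y\<close> on the disc.\<close>
  define \<delta> where "\<delta> = \<eta> / (M\<^sup>2 * norm a)"
  have \<delta>: "\<delta> > 0" using \<eta> M a by (simp add: \<delta>_def)
  have "bounded (poly R ` cball \<zeta> r)"
    by (intro compact_imp_bounded compact_continuous_image continuous_intros) simp
  then obtain B where B: "B > 0" "\<And>z. z \<in> cball \<zeta> r \<Longrightarrow> norm (poly R z) \<le> B"
    unfolding bounded_pos by blast
  have T0: "poly T z \<noteq> 0" if "z \<in> sphere \<zeta> r" for z
    using d(2)[of z] that r by fastforce
  have "bounded ((\<lambda>z. inverse (poly T z)) ` sphere \<zeta> r)"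
    using T0 by (intro compact_imp_bounded compact_continuous_image continuous_intros) auto
  then obtain C where C: "C > 0" "\<And>z. z \<in> sphere \<zeta> r \<Longrightarrow> norm (inverse (poly T z)) \<le> C"
    unfolding bounded_pos by blast
  have T1: "norm (poly T z) \<ge> 1 / C" if "z \<in> sphere \<zeta> r" for z
    using C(2)[OF that] C(1) T0[OF that] unfolding norm_inverse by (simp add: field_simps)
  have ev: "\<forall>\<^sub>F n in sequentially. real n > 2 * B * C / \<delta>"
    using filterlim_real_sequentially unfolding filterlim_at_top_dense by blast
  show ?thesis
  proof (rule eventually_mono[OF ev], intro allI impI)
    fix n A c
    assume n: "real n > 2 * B * C / \<delta>" and A: "A \<subseteq> complex_of_real ` {-1..1}" "finite A" "card A = n"
      and "c \<noteq> (0::complex)"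
    define G where "G = real n * \<delta>"
    have G: "G > 2 * B * C" using n \<delta> by (simp add: G_def field_simps)
    have G0: "G > 0" using G B C by (smt (verit) mult_pos_pos)
    have "A \<noteq> {}" using G0 A by (auto simp: G_def)
    define y where "y = smult c (\<Prod>t\<in>A. [:- t, 1:])"
    define p where "p = T * pderiv y - R * y"
    have y: "norm (poly y z) \<le> norm (poly (pderiv y) z) / G" "poly (pderiv y) z \<noteq> 0" if z: "z \<in> cball \<zeta> r" for z
    proof -
      have zA: "z \<notin> A" using sep[OF _ z, of z] A \<eta> by (auto simp: K_def)
      have "poly y z \<noteq> 0" using zA \<open>c \<noteq> 0\<close> A(2) by (auto simp: y_def poly_prod)
      define g where "g = (\<Sum>t\<in>A. 1 / (z - t))"
      have "norm g \<ge> real (card A) * (\<eta> / (M\<^sup>2 * norm a))" unfolding g_def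
        using A \<open>A \<noteq> {}\<close> \<eta> z by (intro norm_sum_inverse_ge sep bnd) (auto simp: K_def)
      then have g: "norm g \<ge> G" by (simp add: G_def \<delta>_def A)
      have y': "poly (pderiv y) z = poly y z * g"
        unfolding y_def g_def using poly_pderiv_prod_roots[OF A(2) zA] by (simp add: pderiv_smult)
      have "norm (poly y z) * G \<le> norm (poly y z) * norm g" using g by (intro mult_left_mono) auto
      then show "norm (poly y z) \<le> norm (poly (pderiv y) z) / G" using G0 by (simp add: y' norm_mult field_simps)
      show "poly (pderiv y) z \<noteq> 0" using y' g G0 \<open>poly y z \<noteq> 0\<close> by auto
    qed
    have Ry: "norm (poly R z * poly y z) \<le> B / G * norm (poly (pderiv y) z)" if z: "z \<in> cball \<zeta> r" for z
    proof -
      have "norm (poly R z * poly y z) \<le> B * (norm (poly (pderiv y) z) / G)"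
        unfolding norm_mult using B y(1)[OF z] z by (intro mult_mono) auto
      then show ?thesis by simp
    qed
    have "\<exists>\<xi>. dist \<xi> \<zeta> < \<rho> \<and> poly p \<xi> = 0"
    proof (rule ccontr)
      assume "\<not> ?thesis"
      then have p0: "poly p z \<noteq> 0" if "z \<in> cball \<zeta> r" for z
        using that r by (auto simp: dist_commute)
      define F where "F z = poly (pderiv y) z / poly p z" for z
      have contF: "continuous_on (cball \<zeta> r) F" and holF: "F holomorphic_on (ball \<zeta> r)"
        unfolding F_def using p0 by (auto intro!: continuous_intros holomorphic_intros)
      have "norm (F \<zeta>) \<le> 2 * C"
      proof (rule maximum_modulus_frontier[of F "cball \<zeta> r"])
        show "F holomorphic_on interior (cball \<zeta> r)" using holF by simp
        show "continuous_on (closure (cball \<zeta> r)) F" using contF by simp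
        show "norm (F z) \<le> 2 * C" if "z \<in> frontier (cball \<zeta> r)" for z
        proof -
          have zs: "z \<in> sphere \<zeta> r" using that r by simp
          then have zc: "z \<in> cball \<zeta> r" by simp
          define Y where "Y = norm (poly (pderiv y) z)"
          have "Y * (1 / C) \<le> norm (poly T z * poly (pderiv y) z)"
            unfolding norm_mult Y_def
            using mult_right_mono[OF T1[OF zs], of "norm (poly (pderiv y) z)"] by (simp add: mult.commute)
          moreover have "norm (poly R z * poly y z) \<le> Y * (1 / (2 * C))"
          proof -
            \<comment> \<open>This is where \<open>n\<close> must be large: the term with
              \<open>R\<close> takes at most half of the lower bound for the term with
              \<open>T\<close>.\<close>
            have "B / G \<le> 1 / (2 * C)" using G G0 C by (simp add: field_simps)
            then have "B / G * Y \<le> 1 / (2 * C) * Y" by (rule mult_right_mono) (simp add: Y_def)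
            then show ?thesis using Ry[OF zc] by (simp add: Y_def mult.commute)
          qed
          moreover have "poly p z = poly T z * poly (pderiv y) z - poly R z * poly y z" by (simp add: p_def)
          then have "norm (poly p z) \<ge> norm (poly T z * poly (pderiv y) z) - norm (poly R z * poly y z)"
            by (simp add: norm_triangle_ineq2)
          ultimately have "Y * (1 / C) - Y * (1 / (2 * C)) \<le> norm (poly p z)" by linarith
          moreover have "Y * (1 / C) - Y * (1 / (2 * C)) = Y / (2 * C)" using C by (simp add: field_simps)
          ultimately have "Y \<le> 2 * C * norm (poly p z)" using C by (simp add: field_simps)
          then show ?thesis using p0[OF zc] by (simp add: F_def norm_divide Y_def field_simps)
        qed
        show "\<zeta> \<in> cball \<zeta> r" using r by simp
      qed simp
      moreover have "norm (F \<zeta>) \<ge> G / B"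
      proof -
        have z: "\<zeta> \<in> cball \<zeta> r" using r by simp
        \<comment> \<open>At the centre only the small term with \<open>R\<close> is left, so
          \<open>F\<close> is large there.\<close>
        have "poly p \<zeta> = - (poly R \<zeta> * poly y \<zeta>)" by (simp add: p_def assms(2))
        then have "norm (poly p \<zeta>) \<le> B / G * norm (poly (pderiv y) \<zeta>)" using Ry[OF z] by simp
        then have "norm (poly p \<zeta>) * G \<le> B * norm (poly (pderiv y) \<zeta>)" using G0 by (simp add: field_simps)
        then show ?thesis using p0[OF z] B(1) by (simp add: F_def norm_divide field_simps)
      qed
      moreover have "G / B > 2 * C" using G B(1) by (simp add: field_simps)
      ultimately show False by linarith
    qed
    then show "\<exists>\<xi>. dist \<xi> \<zeta> < \<rho> \<and>
        poly (T * pderiv (smult c (\<Prod>t\<in>A. [:- t, 1:])) - R * smult c (\<Prod>t\<in>A. [:- t, 1:])) \<xi> = 0"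
      unfolding p_def y_def .
  qed
qed

section \<open>Complexification and simplicity of roots\<close>

abbreviation cpoly :: "real poly \<Rightarrow> complex poly" where
  "cpoly \<equiv> map_poly complex_of_real"

lemma cpoly_mult: "cpoly (p * q) = cpoly p * cpoly q"
  by (intro poly_eqI) (simp add: coeff_map_poly coeff_mult)

lemma cpoly_add: "cpoly (p + q) = cpoly p + cpoly q"
  by (intro poly_eqI) (simp add: coeff_map_poly)

lemma cpoly_diff: "cpoly (p - q) = cpoly p - cpoly q"
  by (intro poly_eqI) (simp add: coeff_map_poly)

lemma cpoly_smult: "cpoly (smult c p) = smult (of_real c) (cpoly p)"
  by (intro poly_eqI) (simp add: coeff_map_poly)

lemma cpoly_pderiv: "pderiv (cpoly p) = cpoly (pderiv p)"
  by (intro poly_eqI) (simp add: coeff_map_poly coeff_pderiv)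

lemma cpoly_pCons: "cpoly (pCons a p) = pCons (of_real a) (cpoly p)"
  by (simp add: map_poly_pCons)

lemma degree_cpoly: "degree (cpoly p) = degree p"
  by (rule degree_map_poly) auto

lemma cpoly_eq_0_iff: "cpoly p = 0 \<longleftrightarrow> p = 0"
  by (rule map_poly_eq_0_iff) auto

lemma cpoly_power: "cpoly (p ^ n) = cpoly p ^ n"
  by (induction n) (simp_all add: cpoly_mult)

lemma poly_cpoly_of_real: "poly (cpoly p) (of_real x) = of_real (poly p x)"
  by (induction p) (auto simp: map_poly_pCons)

lemma cpoly_prod: "cpoly (\<Prod>x\<in>A. f x) = (\<Prod>x\<in>A. cpoly (f x))"
  by (induction A rule: infinite_finite_induct) (auto simp: cpoly_mult)

text \<open>A multiple root other than \<open>\<plusminus>1\<close> would give the term with the second derivative a smaller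
  order than the other two.\<close>
lemma ode_roots_simple:
  fixes p :: "'a::field_char_0 poly"
  assumes "p \<noteq> 0" and ode: "q * pderiv (pderiv p) + r * pderiv p + smult c p = 0"
    and "poly q z \<noteq> 0" "poly p z = 0"
  shows "poly (pderiv p) z \<noteq> 0"
proof
  assume p1: "poly (pderiv p) z = 0"
  define k where "k = order z (pderiv p)"
  have "pderiv p \<noteq> 0"
  proof
    assume "pderiv p = 0"
    then have "degree p = 0" by (simp add: pderiv_eq_0_iff)
    then show False using assms(1,4) by (auto elim!: degree_eq_zeroE)
  qed
  then have k: "k \<noteq> 0" using p1 by (simp add: k_def order_root)
  have "order z p = Suc k"
    unfolding k_def using assms(1,4) by (intro order_pderiv) (auto simp: order_root)
  moreover have "k = Suc (order z (pderiv (pderiv p)))"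
    unfolding k_def using \<open>pderiv p \<noteq> 0\<close> p1 by (intro order_pderiv) (auto simp: order_root)
  then have k2: "order z (pderiv (pderiv p)) < k" by simp
  ultimately have "[:- z, 1:] ^ k dvd p"
    using dvd_trans[OF le_imp_power_dvd[of k "order z p"] order_1] by simp
  moreover have "[:- z, 1:] ^ k dvd pderiv p"
    unfolding k_def by (rule order_1)
  ultimately have "[:- z, 1:] ^ k dvd r * pderiv p + smult c p" by (intro dvd_add dvd_mult dvd_smult)
  then have "[:- z, 1:] ^ k dvd - (r * pderiv p + smult c p)" by (simp only: dvd_minus_iff)
  also have "- (r * pderiv p + smult c p) = q * pderiv (pderiv p)"
    by (rule sym, rule eq_neg_iff_add_eq_0[THEN iffD2]) (use ode in \<open>simp only: add.assoc\<close>)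
  finally have d: "[:- z, 1:] ^ k dvd q * pderiv (pderiv p)" .
  have "pderiv (pderiv p) \<noteq> 0"
  proof
    assume "pderiv (pderiv p) = 0"
    then have "degree (pderiv p) = 0" by (simp add: pderiv_eq_0_iff)
    then show False using p1 \<open>pderiv p \<noteq> 0\<close> by (auto elim!: degree_eq_zeroE)
  qed
  moreover have "q \<noteq> 0" using assms(3) by auto
  ultimately have "k \<le> order z (q * pderiv (pderiv p))" using d by (simp add: order_divides)
  also have "\<dots> = order z (pderiv (pderiv p))"
    using \<open>pderiv (pderiv p) \<noteq> 0\<close> \<open>q \<noteq> 0\<close> assms(3) by (simp add: order_mult order_0I)
  finally show False using k2 by simp
qed

section \<open>Energy of finite sets\<close>

text \<open>Maxima are matched with maxima, recursively.\<close>

lemma ex_strict_mono_bij_betw: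
  fixes Z :: "'a::linorder set" and A :: "'b::linorder set"
  assumes "finite Z" "finite A" "card A = card Z"
  shows "\<exists>h. bij_betw h Z A \<and> strict_mono_on Z h"
  using assms
proof (induction Z arbitrary: A rule: finite_linorder_max_induct)
  case empty
  then show ?case by (auto simp: strict_mono_on_def bij_betw_def)
next
  case (insert b Z)
  have "b \<notin> Z" using insert.hyps by auto
  then have card: "card A = Suc (card Z)" using insert by simp
  then have "A \<noteq> {}" by auto
  define a where "a = Max A"
  have a: "a \<in> A" "\<And>x. x \<in> A \<Longrightarrow> x \<le> a" using \<open>A \<noteq> {}\<close> insert.prems by (auto simp: a_def)
  have "finite (A - {a})" "card (A - {a}) = card Z" using insert.prems a card by auto
  from insert.IH[OF this] obtain h where h: "bij_betw h Z (A - {a})" "strict_mono_on Z h" by blast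
  define h' where "h' = h(b := a)"
  have "bij_betw h' Z (A - {a})"
    using h(1) \<open>b \<notin> Z\<close> by (subst bij_betw_cong[of Z h' h]) (auto simp: h'_def)
  then have "bij_betw h' (Z \<union> {b}) ((A - {a}) \<union> {a})"
    by (rule bij_betw_combine) (auto simp: h'_def bij_betw_def)
  then have "bij_betw h' (insert b Z) A" using a by (simp add: insert_absorb)
  moreover have "strict_mono_on (insert b Z) h'"
  proof (rule strict_mono_onI)
    fix r s assume rs: "r \<in> insert b Z" "s \<in> insert b Z" "r < s"
    have "h r < a" if "r \<in> Z"
    proof -
      have "h r \<in> A - {a}" using bij_betwE[OF h(1)] that by blast
      then show ?thesis using a(2)[of "h r"] by auto
    qed
    then show "h' r < h' s"
      using rs insert.hyps(2) strict_mono_onD[OF h(2)] \<open>b \<notin> Z\<close> by (auto simp: h'_def)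
  qed
  ultimately show ?case by blast
qed

text \<open>The product runs over ordered pairs: each distance occurs twice, which produces the
  squares in \<open>energy_T\<close> without an ordering of the points.\<close>

definition set_energy :: "(real \<Rightarrow> real) \<Rightarrow> real set \<Rightarrow> real" where
  "set_energy v A = (\<Prod>z\<in>A. v z) * (\<Prod>z\<in>A. \<Prod>w\<in>A - {z}. \<bar>z - w\<bar>)"

lemma set_energy_pos:
  assumes "finite A" "\<And>z. z \<in> A \<Longrightarrow> v z > 0"
  shows "set_energy v A > 0"
  using assms unfolding set_energy_def by (intro mult_pos_pos prod_pos) auto

lemma energy_T_inj:
  assumes "inj_on u {1..n}"
  shows "energy_T v n u = set_energy v (u ` {1..n})"
proof -
  have "(\<Prod>j = 1..n. \<Prod>i = 1..<j. (u i - u j)\<^sup>2) = (\<Prod>j\<in>{1..n}. \<Prod>i\<in>{1..n} - {j}. \<bar>u j - u i\<bar>)"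
  proof (induction n)
    case (Suc n)
    have "(\<Prod>j\<in>{1..n}. \<Prod>i\<in>{1..Suc n} - {j}. \<bar>u j - u i\<bar>)
        = (\<Prod>j\<in>{1..n}. \<bar>u j - u (Suc n)\<bar> * (\<Prod>i\<in>{1..n} - {j}. \<bar>u j - u i\<bar>))"
    proof (rule prod.cong[OF refl], goal_cases)
      case (1 j)
      then have "{1..Suc n} - {j} = insert (Suc n) ({1..n} - {j})" by auto
      then show ?case by simp
    qed
    moreover have "{1..Suc n} - {Suc n} = {1..n}" by auto
    ultimately have "(\<Prod>j\<in>{1..Suc n}. \<Prod>i\<in>{1..Suc n} - {j}. \<bar>u j - u i\<bar>)
        = (\<Prod>j\<in>{1..n}. \<Prod>i\<in>{1..n} - {j}. \<bar>u j - u i\<bar>) * ((\<Prod>i\<in>{1..n}. \<bar>u i - u (Suc n)\<bar>) * (\<Prod>i\<in>{1..n}. \<bar>u (Suc n) - u i\<bar>))"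
      by (simp add: prod.distrib)
    also have "(\<Prod>i\<in>{1..n}. \<bar>u i - u (Suc n)\<bar>) * (\<Prod>i\<in>{1..n}. \<bar>u (Suc n) - u i\<bar>) = (\<Prod>i = 1..<Suc n. (u i - u (Suc n))\<^sup>2)"
    proof -
      have "\<bar>a - b\<bar> * \<bar>b - a\<bar> = (a - b)\<^sup>2" for a b :: real
        by (metis abs_minus_commute abs_mult_self_eq power2_eq_square)
      then show ?thesis unfolding prod.distrib[symmetric] atLeastLessThanSuc_atLeastAtMost by simp
    qed
    finally have R: "(\<Prod>j\<in>{1..Suc n}. \<Prod>i\<in>{1..Suc n} - {j}. \<bar>u j - u i\<bar>)
        = (\<Prod>j\<in>{1..n}. \<Prod>i\<in>{1..n} - {j}. \<bar>u j - u i\<bar>) * (\<Prod>i = 1..<Suc n. (u i - u (Suc n))\<^sup>2)" .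
    have L: "(\<Prod>j = 1..Suc n. \<Prod>i = 1..<j. (u i - u j)\<^sup>2)
        = (\<Prod>i = 1..<Suc n. (u i - u (Suc n))\<^sup>2) * (\<Prod>j = 1..n. \<Prod>i = 1..<j. (u i - u j)\<^sup>2)"
      by (rule prod.nat_ivl_Suc') simp
    show ?case unfolding L R Suc.IH by (rule mult.commute)
  qed simp
  moreover have "(\<Prod>z\<in>u ` {1..n}. \<Prod>w\<in>u ` {1..n} - {z}. \<bar>z - w\<bar>) = (\<Prod>j\<in>{1..n}. \<Prod>i\<in>{1..n} - {j}. \<bar>u j - u i\<bar>)"
    unfolding prod.reindex[OF assms] o_def
  proof (rule prod.cong[OF refl], goal_cases)
    case (1 j)
    then have "u ` {1..n} - {u j} = u ` ({1..n} - {j})"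
      using inj_on_image_set_diff[OF assms, of "{1..n}" "{j}"] by simp
    moreover have "inj_on u ({1..n} - {j})" using assms by (rule inj_on_subset) auto
    ultimately show ?case by (simp add: prod.reindex)
  qed
  ultimately show ?thesis unfolding energy_T_def set_energy_def prod.reindex[OF assms] by (simp add: o_def)
qed

lemma energy_T_not_inj:
  assumes "\<not> inj_on u {1..n}"
  shows "energy_T v n u = 0"
proof -
  from assms obtain i j where ij: "i \<in> {1..n}" "j \<in> {1..n}" "i < j" "u i = u j"
    unfolding inj_on_def by (metis linorder_neqE_nat)
  then have "(\<Prod>i = 1..<j. (u i - u j)\<^sup>2) = 0" by (intro prod_zero bexI[of _ i]) auto
  with ij(2) have "\<exists>j\<in>{1..n}. (\<Prod>i = 1..<j. (u i - u j)\<^sup>2) = 0" by blast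
  then have "(\<Prod>j = 1..n. \<Prod>i = 1..<j. (u i - u j)\<^sup>2) = 0"
    by (rule prod_zero[rotated]) simp
  then show ?thesis by (simp add: energy_T_def)
qed

text \<open>With \<open>A\<close> parametrized by \<open>Z\<close>, the energies of the two sets can
  be compared term by term.\<close>

lemma set_energy_reindex:
  assumes h: "bij_betw h Z A" and "finite Z" "\<And>z. z \<in> A \<Longrightarrow> v z > 0"
  shows "ln (set_energy v A) = (\<Sum>z\<in>Z. ln (v (h z))) + (\<Sum>z\<in>Z. \<Sum>w\<in>Z - {z}. ln \<bar>h z - h w\<bar>)"
proof -
  have A: "finite A" using assms bij_betw_finite by blast
  have inner: "(\<Prod>w\<in>A - {h z}. \<bar>h z - w\<bar>) = (\<Prod>w\<in>Z - {z}. \<bar>h z - h w\<bar>)" if "z \<in> Z" for z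
  proof -
    have "bij_betw h (Z - {z}) (A - {h z})"
      using h that by (simp add: bij_betw_DiffI bij_betw_def) (auto simp: inj_on_def)
    then show ?thesis by (rule prod.reindex_bij_betw[symmetric])
  qed
  have "set_energy v A = (\<Prod>z\<in>Z. v (h z)) * (\<Prod>z\<in>Z. \<Prod>w\<in>Z - {z}. \<bar>h z - h w\<bar>)"
    unfolding set_energy_def
      prod.reindex_bij_betw[OF h, of v, symmetric]
      prod.reindex_bij_betw[OF h, of "\<lambda>z. \<Prod>w\<in>A - {z}. \<bar>z - w\<bar>", symmetric]
    using inner by simp
  moreover have pv: "v (h z) > 0" if "z \<in> Z" for z using assms that bij_betwE[OF h] by blast
  moreover have ph: "\<bar>h z - h w\<bar> > 0" if "z \<in> Z" "w \<in> Z - {z}" for z w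
    using h that by (auto simp: bij_betw_def inj_on_def)
  moreover have "ln (\<Prod>z\<in>Z. \<Prod>w\<in>Z - {z}. \<bar>h z - h w\<bar>) = (\<Sum>z\<in>Z. \<Sum>w\<in>Z - {z}. ln \<bar>h z - h w\<bar>)"
    using assms ph by (subst ln_prod; (intro sum.cong refl ln_prod)?) (auto intro!: prod_pos)
  moreover have "ln (\<Prod>z\<in>Z. v (h z)) = (\<Sum>z\<in>Z. ln (v (h z)))"
    using assms(2) by (intro ln_prod) (use pv in force)+
  moreover have "(\<Prod>z\<in>Z. v (h z)) > 0" "(\<Prod>z\<in>Z. \<Prod>w\<in>Z - {z}. \<bar>h z - h w\<bar>) > 0"
    by (intro prod_pos ballI pv ph; assumption)+
  ultimately show ?thesis by (simp add: ln_mult)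
qed

text \<open>Matching \<open>A\<close> with \<open>Z\<close> in increasing order makes all quotients
  \<open>(h z - h w) / (z - w)\<close> positive, so that \<open>ln t \<le> t - 1\<close> linearizes the interaction term.\<close>
lemma set_energy_less:
  assumes Z: "finite Z" "Z \<subseteq> I" and A: "finite A" "A \<subseteq> I" "card A = card Z" "A \<noteq> Z"
    and v: "\<And>z. z \<in> I \<Longrightarrow> v z > 0"
    and tangent: "\<And>z u. z \<in> Z \<Longrightarrow> u \<in> I \<Longrightarrow> u \<noteq> z \<Longrightarrow> ln (v u) - ln (v z) < d z * (u - z)"
    and critical: "\<And>z. z \<in> Z \<Longrightarrow> d z + 2 * (\<Sum>w\<in>Z - {z}. 1 / (z - w)) = 0"
  shows "set_energy v A < set_energy v Z"
proof -
  obtain h where h: "bij_betw h Z A" "strict_mono_on Z h"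
    using ex_strict_mono_bij_betw[OF Z(1) A(1,3)] by blast
  define e where "e z = h z - z" for z
  have hI: "h z \<in> I" if "z \<in> Z" for z using bij_betwE[OF h(1)] that A(2) by blast
  have "\<exists>z\<in>Z. h z \<noteq> z"
  proof (rule ccontr)
    assume "\<not> ?thesis"
    then have "h ` Z = Z" by force
    then show False using h(1) A(4) by (simp add: bij_betw_def)
  qed
  then obtain z0 where z0: "z0 \<in> Z" "h z0 \<noteq> z0" by blast
  have lnA: "ln (set_energy v A) = (\<Sum>z\<in>Z. ln (v (h z))) + (\<Sum>z\<in>Z. \<Sum>w\<in>Z - {z}. ln \<bar>h z - h w\<bar>)"
    using h(1) Z(1) A(2) v by (intro set_energy_reindex) auto
  have lnZ: "ln (set_energy v Z) = (\<Sum>z\<in>Z. ln (v (id z))) + (\<Sum>z\<in>Z. \<Sum>w\<in>Z - {z}. ln \<bar>id z - id w\<bar>)"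
    using Z v by (intro set_energy_reindex bij_betw_id) auto
  have pair: "ln \<bar>h z - h w\<bar> - ln \<bar>z - w\<bar> \<le> e z / (z - w) + e w / (w - z)" if "z \<in> Z" "w \<in> Z - {z}" for z w
  proof -
    have "z < w \<or> w < z" using that by auto
    then have q: "(h z - h w) / (z - w) > 0"
      using strict_mono_onD[OF h(2), of z w] strict_mono_onD[OF h(2), of w z] that
      by (auto simp: zero_less_divide_iff)
    have "ln \<bar>h z - h w\<bar> - ln \<bar>z - w\<bar> = ln ((h z - h w) / (z - w))"
    proof -
      have "(h z - h w) / (z - w) = \<bar>h z - h w\<bar> / \<bar>z - w\<bar>"
        using q by (simp flip: abs_divide)
      moreover have "\<bar>h z - h w\<bar> > 0" "\<bar>z - w\<bar> > 0" using q by auto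
      ultimately show ?thesis by (simp add: ln_div)
    qed
    also have "\<dots> \<le> (h z - h w) / (z - w) - 1" using q by (rule ln_le_minus_one)
    also have "\<dots> = e z / (z - w) + e w / (w - z)"
    proof -
      have "e w / (w - z) = - (e w / (z - w))"
        by (metis minus_diff_eq minus_divide_right)
      moreover have "1 = (z - w) / (z - w)" using that by simp
      ultimately have "(h z - h w) / (z - w) - 1 - (e z / (z - w) + e w / (w - z))
          = ((h z - h w) - (z - w) - (e z - e w)) / (z - w)"
        by (simp only: diff_divide_distrib)
      then show ?thesis by (simp add: e_def)
    qed
    finally show ?thesis .
  qed
  \<comment> \<open>The diagonal term is a division by zero and hence 0, so the sums may run over
    all of \<open>Z\<close>, where the order of summation can be exchanged.\<close>
  have rem: "(\<Sum>w\<in>Z - {z}. f w / (z - w)) = (\<Sum>w\<in>Z. f w / (z - w))" for f z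
    using Z(1) by (intro sum.mono_neutral_left) auto
  have rem': "(\<Sum>w\<in>Z - {z}. f w / (w - z)) = (\<Sum>w\<in>Z. f w / (w - z))" for f z
    using Z(1) by (intro sum.mono_neutral_left) auto
  have "(\<Sum>z\<in>Z. \<Sum>w\<in>Z - {z}. ln \<bar>h z - h w\<bar>) - (\<Sum>z\<in>Z. \<Sum>w\<in>Z - {z}. ln \<bar>z - w\<bar>)
      \<le> (\<Sum>z\<in>Z. \<Sum>w\<in>Z - {z}. e z / (z - w) + e w / (w - z))"
    unfolding sum_subtractf[symmetric] by (intro sum_mono pair)
  also have "\<dots> = (\<Sum>z\<in>Z. \<Sum>w\<in>Z. e z / (z - w)) + (\<Sum>z\<in>Z. \<Sum>w\<in>Z. e w / (w - z))"
    unfolding sum.distrib rem rem' ..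
  also have "(\<Sum>z\<in>Z. \<Sum>w\<in>Z. e w / (w - z)) = (\<Sum>z\<in>Z. \<Sum>w\<in>Z. e z / (z - w))" by (rule sum.swap)
  also have "(\<Sum>z\<in>Z. \<Sum>w\<in>Z. e z / (z - w)) + (\<Sum>z\<in>Z. \<Sum>w\<in>Z. e z / (z - w))
      = (\<Sum>z\<in>Z. e z * (2 * (\<Sum>w\<in>Z - {z}. 1 / (z - w))))"
    unfolding rem by (simp add: sum_distrib_left sum.distrib[symmetric] mult.commute)
  finally have inter: "(\<Sum>z\<in>Z. \<Sum>w\<in>Z - {z}. ln \<bar>h z - h w\<bar>) - (\<Sum>z\<in>Z. \<Sum>w\<in>Z - {z}. ln \<bar>z - w\<bar>)
      \<le> (\<Sum>z\<in>Z. e z * (2 * (\<Sum>w\<in>Z - {z}. 1 / (z - w))))" .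
  \<comment> \<open>Strictness comes from the field term alone, at a point \<open>z0\<close> that is
    moved by \<open>h\<close>.\<close>
  have "(\<Sum>z\<in>Z. ln (v (h z))) - (\<Sum>z\<in>Z. ln (v z)) < (\<Sum>z\<in>Z. e z * d z)"
    unfolding sum_subtractf[symmetric]
  proof (rule sum_strict_mono_ex1)
    show "\<forall>z\<in>Z. ln (v (h z)) - ln (v z) \<le> e z * d z"
    proof
      fix z assume "z \<in> Z"
      then show "ln (v (h z)) - ln (v z) \<le> e z * d z"
        using tangent[of z "h z"] hI[of z] by (cases "h z = z") (auto simp: e_def mult.commute)
    qed
    show "\<exists>z\<in>Z. ln (v (h z)) - ln (v z) < e z * d z"
      using z0 tangent[of z0 "h z0"] hI[of z0] by (intro bexI[of _ z0]) (auto simp: e_def mult.commute)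
  qed (rule Z)
  then have "ln (set_energy v A) - ln (set_energy v Z)
     < (\<Sum>z\<in>Z. e z * d z) + (\<Sum>z\<in>Z. e z * (2 * (\<Sum>w\<in>Z - {z}. 1 / (z - w))))"
    unfolding lnA lnZ using inter by simp
  also have "\<dots> = (\<Sum>z\<in>Z. e z * (d z + 2 * (\<Sum>w\<in>Z - {z}. 1 / (z - w))))"
    by (simp add: sum.distrib[symmetric] distrib_left)
  also have "\<dots> = 0" using critical by simp
  finally have "ln (set_energy v A) < ln (set_energy v Z)" by simp
  moreover have "set_energy v A > 0" "set_energy v Z > 0"
    using A Z v by (auto intro!: set_energy_pos)
  ultimately show ?thesis by simp
qed

text \<open>Points with a repetition have energy 0, and otherwise the energy depends only on the set
  of values, so \<open>set_energy_less\<close> decides. The function \<open>d\<close> plays the role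
  of the derivative of \<open>ln v\<close>.\<close>

lemma is_arg_max_energy_T:
  assumes Z: "finite Z" "Z \<subseteq> I"
    and v: "\<And>z. z \<in> I \<Longrightarrow> v z > 0"
    and tangent: "\<And>z u. z \<in> Z \<Longrightarrow> u \<in> I \<Longrightarrow> u \<noteq> z \<Longrightarrow> ln (v u) - ln (v z) < d z * (u - z)"
    and critical: "\<And>z. z \<in> Z \<Longrightarrow> d z + 2 * (\<Sum>w\<in>Z - {z}. 1 / (z - w)) = 0"
  shows "is_arg_max (energy_T v (card Z)) (\<lambda>u. u \<in> {1..card Z} \<rightarrow> I) u \<longleftrightarrow> u ` {1..card Z} = Z"
proof -
  define n where "n = card Z"
  have T_le: "energy_T v n u < set_energy v Z" if "u \<in> {1..n} \<rightarrow> I" "u ` {1..n} \<noteq> Z" for u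
  proof (cases "inj_on u {1..n}")
    case True
    then have "card (u ` {1..n}) = card Z" by (simp add: card_image n_def)
    then show ?thesis unfolding energy_T_inj[OF True]
      using that by (intro set_energy_less[OF Z _ _ _ _ v tangent critical]) auto
  next
    case False
    then show ?thesis using Z v by (auto simp: energy_T_not_inj intro!: set_energy_pos)
  qed
  have T_eq: "energy_T v n u = set_energy v Z" if "u ` {1..n} = Z" for u
  proof -
    have "inj_on u {1..n}" using that by (intro eq_card_imp_inj_on) (auto simp: n_def)
    then show ?thesis using energy_T_inj that by metis
  qed
  obtain u0 where "bij_betw u0 {1..n} Z" unfolding n_def using ex_bij_betw_nat_finite_1[OF Z(1)] by blast
  then have u0: "u0 ` {1..n} = Z" "u0 \<in> {1..n} \<rightarrow> I" using Z(2) by (auto simp: bij_betw_def)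
  have "is_arg_max (energy_T v n) (\<lambda>u. u \<in> {1..n} \<rightarrow> I) u \<longleftrightarrow> u ` {1..n} = Z"
  proof
    assume "is_arg_max (energy_T v n) (\<lambda>u. u \<in> {1..n} \<rightarrow> I) u"
    then have u: "u \<in> {1..n} \<rightarrow> I" "\<not> energy_T v n u < energy_T v n u0"
      using u0 unfolding is_arg_max_def by auto
    then show "u ` {1..n} = Z" using T_le[OF u(1)] T_eq[OF u0(1)] by auto
  next
    assume u: "u ` {1..n} = Z"
    then have "u \<in> {1..n} \<rightarrow> I" using Z(2) by auto
    then show "is_arg_max (energy_T v n) (\<lambda>u. u \<in> {1..n} \<rightarrow> I) u"
      unfolding is_arg_max_def T_eq[OF u] using T_le T_eq by (metis less_irrefl less_asym)
  qed
  then show ?thesis unfolding n_def .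
qed

section \<open>Exceptional zeros\<close>

text \<open>The arithmetic hypothesis keeps the top coefficient away from 0, and the differential
  equation makes the roots simple because \<open>S\<close> does not vanish at 1 and -1.\<close>

lemma xjacobi_S_roots:
  assumes "\<alpha> > real m - 1" "\<beta> > 0" "\<alpha> + 1 - real m - \<beta> \<notin> real ` {0..m - 1}"
  obtains X s where "finite X" "card X = m" "s \<noteq> 0" "X \<inter> complex_of_real ` {-1..1} = {}"
    "cpoly (xjacobi_S m \<alpha> \<beta>) = smult s (\<Prod>\<zeta>\<in>X. [:- \<zeta>, 1:])"
proof -
  define S where "S = xjacobi_S m \<alpha> \<beta>"
  have S: "poly S x \<noteq> 0" if "-1 \<le> x" "x \<le> 1" for x
    unfolding S_def by (rule xjacobi_S_nonzero[OF assms(1,2) that])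
  then have "S \<noteq> 0" by force
  have "coeff S m \<noteq> 0"
  proof
    assume "coeff S m = 0"
    then have "(2 * real m - \<alpha> + \<beta> - 2) gchoose m = 0"
      unfolding S_def xjacobi_S_def coeff_jacobi_poly_top by (simp add: algebra_simps)
    then obtain k where k: "k < m" "2 * real m - \<alpha> + \<beta> - 2 = real k"
      unfolding gbinomial_prod_rev by auto
    \<comment> \<open>The reflection of \<open>k\<close> to \<open>m - 1 - k\<close> turns the
      vanishing condition into the excluded set.\<close>
    then have "\<alpha> + 1 - real m - \<beta> = real (m - 1 - k)" by (simp add: of_nat_diff)
    then show False using assms(3) by auto
  qed
  then have "degree S = m"
    using degree_jacobi_poly_le[of m] le_degree[of S m] unfolding S_def xjacobi_S_def by (metis le_antisym)
  define X where "X = {z. poly (cpoly S) z = 0}"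
  have XK: "X \<inter> complex_of_real ` {-1..1} = {}"
    using S by (auto simp: X_def poly_cpoly_of_real)
  have "rsquarefree (cpoly S)"
    unfolding rsquarefree_roots
  proof (intro allI notI)
    fix z assume z: "poly (cpoly S) z = 0 \<and> poly (pderiv (cpoly S)) z = 0"
    define M where "M = real m * (real m + \<beta> - \<alpha> - 1)"
    have "[:1, 0, -1:] * pderiv (pderiv S) + [:\<alpha> + \<beta>, - (\<beta> - \<alpha>):] * pderiv S + smult M S = 0"
    proof (rule poly_ext)
      fix z
      show "poly ([:1, 0, -1:] * pderiv (pderiv S) + [:\<alpha> + \<beta>, - (\<beta> - \<alpha>):] * pderiv S + smult M S) z = poly 0 z"
        using jacobi_poly_ode[of z m "- \<alpha> - 1" "\<beta> - 1"]
        unfolding S_def xjacobi_S_def M_def by (simp add: algebra_simps power2_eq_square)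
    qed
    then have "cpoly ([:1, 0, -1:] * pderiv (pderiv S) + [:\<alpha> + \<beta>, - (\<beta> - \<alpha>):] * pderiv S + smult M S) = 0"
      by simp
    then have ode: "cpoly [:1, 0, -1:] * pderiv (pderiv (cpoly S)) + cpoly [:\<alpha> + \<beta>, - (\<beta> - \<alpha>):] * pderiv (cpoly S)
        + smult (of_real M) (cpoly S) = 0"
      unfolding cpoly_add cpoly_mult cpoly_smult cpoly_pderiv .
    have "poly (cpoly [:1, 0, -1:]) z \<noteq> 0"
    proof
      assume "poly (cpoly [:1, 0, -1:]) z = 0"
      then have "z * z = 1" by (simp add: cpoly_pCons)
      then have "z = of_real 1 \<or> z = of_real (-1)" by (simp add: square_eq_1_iff)
      then have "z \<in> complex_of_real ` {-1..1}"
        using image_eqI[of z complex_of_real 1 "{-1..1}"] image_eqI[of z complex_of_real "-1" "{-1..1}"] by auto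
      then show False using z XK by (auto simp: X_def)
    qed
    then show False using ode_roots_simple[OF _ ode, of z] z \<open>S \<noteq> 0\<close> by (simp add: cpoly_eq_0_iff)
  qed
  then have fac: "smult (lead_coeff (cpoly S)) (\<Prod>\<zeta>\<in>X. [:- \<zeta>, 1:]) = cpoly S"
    unfolding X_def by (rule complex_poly_decompose_rsquarefree)
  have "lead_coeff (cpoly S) \<noteq> 0" using \<open>S \<noteq> 0\<close> by (simp add: cpoly_eq_0_iff)
  moreover have "finite X" unfolding X_def using \<open>S \<noteq> 0\<close> by (intro poly_roots_finite) (simp add: cpoly_eq_0_iff)
  moreover have "card X = m"
  proof -
    have "degree (cpoly S) = degree (\<Prod>\<zeta>\<in>X. [:- \<zeta>, 1:])"
      using \<open>lead_coeff (cpoly S) \<noteq> 0\<close> by (subst fac[symmetric]) simp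
    also have "\<dots> = card X" by (subst degree_prod_eq_sum_degree) auto
    finally show ?thesis using \<open>degree S = m\<close> by (simp add: degree_cpoly)
  qed
  ultimately show ?thesis using that XK fac unfolding S_def by metis
qed

text \<open>\<open>T\<close> and \<open>R\<close> are the coefficients of the Darboux transform in
  the derivative of \<open>y\<close> and in \<open>y\<close>; uniqueness up to a factor carries its
  zeros over to every exceptional polynomial.\<close>

lemma eventually_exceptional_zeros_near:
  assumes "m \<ge> 1" "\<alpha> > real m - 1" "\<beta> > 0" "\<rho> > 0" "finite X"
    and X: "\<And>\<zeta>. \<zeta> \<in> X \<Longrightarrow> poly (cpoly (xjacobi_S m \<alpha> \<beta>)) \<zeta> = 0"
  shows "\<forall>\<^sub>F n in sequentially. \<forall>p. exceptional_jacobi m n \<alpha> \<beta> p \<longrightarrow>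
     (\<forall>\<zeta>\<in>X. \<exists>\<xi>. dist \<xi> \<zeta> < \<rho> \<and> poly (cpoly p) \<xi> = 0)"
proof -
  define S where "S = xjacobi_S m \<alpha> \<beta>"
  define T where "T = cpoly ([:1, -1:] * S)"
  define R where "R = cpoly (smult (\<alpha> + 1) S + [:1, -1:] * pderiv S)"
  have S: "poly S x \<noteq> 0" if "-1 \<le> x" "x \<le> 1" for x
    unfolding S_def by (rule xjacobi_S_nonzero[OF assms(2,3) that])
  then have "S \<noteq> 0" by force
  have "\<forall>\<^sub>F n in sequentially. \<forall>\<zeta>\<in>X. \<forall>A c. A \<subseteq> complex_of_real ` {-1..1} \<longrightarrow> finite A \<longrightarrow> card A = n \<longrightarrow> c \<noteq> 0 \<longrightarrow>
    (\<exists>\<xi>. dist \<xi> \<zeta> < \<rho> \<and>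
      poly (T * pderiv (smult c (\<Prod>t\<in>A. [:- t, 1:])) - R * smult c (\<Prod>t\<in>A. [:- t, 1:])) \<xi> = 0)"
  proof (intro eventually_ball_finite[OF assms(5)] ballI eventually_zero_near)
    fix \<zeta> assume "\<zeta> \<in> X"
    show "T \<noteq> 0" using \<open>S \<noteq> 0\<close> unfolding T_def cpoly_eq_0_iff by (simp del: mult_pCons_left)
    show "poly T \<zeta> = 0" using X[OF \<open>\<zeta> \<in> X\<close>] by (simp add: T_def S_def cpoly_mult del: mult_pCons_left)
    show "\<zeta> \<notin> complex_of_real ` {-1..1}"
      using X[OF \<open>\<zeta> \<in> X\<close>] S by (auto simp: poly_cpoly_of_real S_def)
  qed (rule assms)
  then show ?thesis
  proof (rule eventually_mono, intro allI impI ballI)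
    fix n p \<zeta>
    assume ev: "\<forall>\<zeta>\<in>X. \<forall>A c. A \<subseteq> complex_of_real ` {-1..1} \<longrightarrow> finite A \<longrightarrow> card A = n \<longrightarrow> c \<noteq> 0 \<longrightarrow>
      (\<exists>\<xi>. dist \<xi> \<zeta> < \<rho> \<and>
        poly (T * pderiv (smult c (\<Prod>t\<in>A. [:- t, 1:])) - R * smult c (\<Prod>t\<in>A. [:- t, 1:])) \<xi> = 0)"
      and p: "exceptional_jacobi m n \<alpha> \<beta> p" and "\<zeta> \<in> X"
    have "p \<noteq> 0" using p assms(1) by (auto simp: exceptional_jacobi_def)
    then obtain k where k: "k \<noteq> 0" "xjacobi m n \<alpha> \<beta> = smult k p"
      using exceptional_jacobi_unique[OF assms(2,3) p] by blast
    define y where "y = jacobi_poly n (\<alpha> + 1) (\<beta> - 1)"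
    obtain Y c where Y: "finite Y" "Y \<subseteq> {-1<..<1}" "card Y = n" "c \<noteq> 0" "y = smult c (\<Prod>t\<in>Y. [:- t, 1:])"
      unfolding y_def by (rule jacobi_poly_zeros[of "\<alpha> + 1" "\<beta> - 1" n]) (use assms in auto)
    define A where "A = complex_of_real ` Y"
    have A: "A \<subseteq> complex_of_real ` {-1..1}" "finite A" "card A = n"
      using Y by (auto simp: A_def card_image inj_on_def)
    have cy: "cpoly y = smult (of_real c) (\<Prod>t\<in>A. [:- t, 1:])"
      unfolding Y(5) A_def cpoly_smult cpoly_prod
      by (subst prod.reindex) (auto simp: inj_on_def cpoly_pCons)
    have "of_real c \<noteq> (0::complex)" using Y by simp
    with ev \<open>\<zeta> \<in> X\<close> A obtain \<xi> where \<xi>: "dist \<xi> \<zeta> < \<rho>" "poly (T * pderiv (cpoly y) - R * cpoly y) \<xi> = 0"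
      unfolding cy by blast
    have "T * pderiv (cpoly y) - R * cpoly y = cpoly (xjacobi m n \<alpha> \<beta>)"
      unfolding xjacobi_def Let_def T_def R_def S_def y_def cpoly_pderiv cpoly_mult cpoly_add cpoly_diff ..
    then have "poly (cpoly p) \<xi> = 0" using \<xi>(2) k by (simp add: cpoly_smult)
    then show "\<exists>\<xi>. dist \<xi> \<zeta> < \<rho> \<and> poly (cpoly p) \<xi> = 0" using \<xi>(1) by blast
  qed
qed

text \<open>A count of degrees: at least \<open>n\<close> zeros in the interval and the
  \<open>m\<close> zeros in \<open>\<Xi>\<close> exhaust the degree \<open>m + n\<close>, so every
  inequality is an equality and all these zeros are simple.\<close>

lemma exceptional_jacobi_zeros_structure:
  assumes "m \<ge> 1" "\<alpha> > real m - 1" "\<beta> > 0" and p: "exceptional_jacobi m n \<alpha> \<beta> p"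
    and \<Xi>: "finite \<Xi>" "card \<Xi> = m" "\<Xi> \<inter> complex_of_real ` {-1..1} = {}" "\<And>\<xi>. \<xi> \<in> \<Xi> \<Longrightarrow> poly (cpoly p) \<xi> = 0"
  obtains e where "card (regular_zeros p) = n" "\<And>x. x \<in> regular_zeros p \<Longrightarrow> order x p = 1" "e \<noteq> 0"
    "cpoly (exceptional_factor p) = smult e (\<Prod>\<xi>\<in>\<Xi>. [:- \<xi>, 1:])"
proof -
  define Z where "Z = regular_zeros p"
  define E where "E = exceptional_factor p"
  define q where "q = regular_factor p"
  have dp: "degree p = m + n" using p by (auto simp: exceptional_jacobi_def)
  then have "p \<noteq> 0" using assms(1) by auto
  then have pEq: "p = E * q" unfolding E_def q_def by (rule regular_exceptional_factorization)
  have nz: "E \<noteq> 0" "q \<noteq> 0" using \<open>p \<noteq> 0\<close> pEq by auto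
  have Z: "finite Z" "Z \<subseteq> {-1<..<1}"
    using finite_subset[OF _ poly_roots_finite[OF \<open>p \<noteq> 0\<close>], of Z] by (auto simp: Z_def regular_zeros_def)
  obtain k where k: "k \<noteq> 0" "xjacobi m n \<alpha> \<beta> = smult k p"
    using exceptional_jacobi_unique[OF assms(2,3) p \<open>p \<noteq> 0\<close>] by blast
  obtain B where B: "finite B" "B \<subseteq> {-1<..<1}" "n \<le> card B" "\<And>x. x \<in> B \<Longrightarrow> poly (xjacobi m n \<alpha> \<beta>) x = 0"
    using xjacobi_zeros[OF assms(2,3)] by blast
  have "B \<subseteq> Z" using B(2,4) k by (auto simp: Z_def regular_zeros_def)
  then have nZ: "n \<le> card Z" by (rule order.trans[OF B(3) card_mono[OF Z(1)]])
  have dq: "degree q = (\<Sum>x\<in>Z. order x p)"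
    unfolding q_def regular_factor_def Z_def[symmetric]
    by (subst degree_prod_eq_sum_degree) (auto simp: degree_power_eq)
  have ord: "order x p \<ge> 1" if "x \<in> Z" for x
    using that \<open>p \<noteq> 0\<close> by (simp add: Z_def regular_zeros_def order_root Suc_le_eq)
  have "poly (cpoly E) \<xi> = 0" if "\<xi> \<in> \<Xi>" for \<xi>
  proof -
    have "\<xi> \<noteq> of_real x" if "x \<in> Z" for x
      using \<open>\<xi> \<in> \<Xi>\<close> \<Xi>(3) Z(2) that by fastforce
    then have "poly (cpoly q) \<xi> \<noteq> 0"
      unfolding q_def regular_factor_def Z_def[symmetric] cpoly_prod poly_prod using Z(1)
      by (auto simp: cpoly_power cpoly_pCons)
    then show ?thesis using \<Xi>(4)[OF that] by (simp add: pEq cpoly_mult)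
  qed
  then have "\<Xi> \<subseteq> {z. poly (cpoly E) z = 0}" by auto
  then have "card \<Xi> \<le> card {z. poly (cpoly E) z = 0}"
    using nz by (intro card_mono poly_roots_finite) (simp add: cpoly_eq_0_iff)
  also have "\<dots> \<le> degree E"
    using card_poly_roots_bound[of "cpoly E"] nz by (simp add: cpoly_eq_0_iff degree_cpoly)
  finally have dE: "m \<le> degree E" using \<Xi>(2) by simp
  have "degree E + degree q = m + n" using dp nz unfolding pEq by (simp add: degree_mult_eq)
  moreover have sum_ge: "card Z \<le> (\<Sum>x\<in>Z. order x p)"
    using sum_mono[of Z "\<lambda>_. 1" "\<lambda>x. order x p"] ord by simp
  ultimately have eq: "degree E = m" "card Z = n" "(\<Sum>x\<in>Z. order x p) = card Z"
    using dE nZ dq by linarith+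
  have ord1: "order x p = 1" if "x \<in> Z" for x
  proof (rule ccontr)
    assume "order x p \<noteq> 1"
    then have "order x p > 1" using ord[OF that] by simp
    then have "(\<Sum>x\<in>Z. 1) < (\<Sum>x\<in>Z. order x p)"
      using ord that by (intro sum_strict_mono_ex1 Z(1) bexI[of _ x]) auto
    then show False using eq(3) by simp
  qed
  have "cpoly E = smult (coeff (cpoly E) (card \<Xi>)) (\<Prod>\<xi>\<in>\<Xi>. [:- \<xi>, 1:])"
    using \<open>\<Xi> \<subseteq> _\<close> eq(1) \<Xi> by (intro poly_eq_prod_roots) (auto simp: degree_cpoly)
  moreover from this have "coeff (cpoly E) (card \<Xi>) \<noteq> 0" using nz by (metis cpoly_eq_0_iff smult_0_left)
  ultimately show ?thesis using that eq(2) ord1 unfolding Z_def E_def by blast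
qed

lemma logderiv_real_poly:
  assumes "cpoly p = smult e (\<Prod>\<xi>\<in>A. [:- \<xi>, 1:])" "e \<noteq> 0" "finite A" "complex_of_real x \<notin> A"
  shows "poly p x \<noteq> 0"
    and "complex_of_real (poly (pderiv p) x / poly p x) = (\<Sum>\<xi>\<in>A. 1 / (of_real x - \<xi>))"
proof -
  have nz: "poly (\<Prod>\<xi>\<in>A. [:- \<xi>, 1:]) (complex_of_real x) \<noteq> 0"
    using assms(3,4) by (auto simp: poly_prod)
  then have "poly (cpoly p) (of_real x) \<noteq> 0" unfolding assms(1) using assms(2) by simp
  then show "poly p x \<noteq> 0" by (simp add: poly_cpoly_of_real)
  have "complex_of_real (poly (pderiv p) x / poly p x) = poly (pderiv (cpoly p)) (of_real x) / poly (cpoly p) (of_real x)"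
    by (simp add: cpoly_pderiv poly_cpoly_of_real)
  also have "\<dots> = (\<Sum>\<xi>\<in>A. 1 / (of_real x - \<xi>))"
    unfolding assms(1) pderiv_smult poly_smult poly_pderiv_prod_roots[OF assms(3,4)] using nz assms(2) by simp
  finally show "complex_of_real (poly (pderiv p) x / poly p x) = (\<Sum>\<xi>\<in>A. 1 / (of_real x - \<xi>))" .
qed

section \<open>Perturbed poles, concavity and the critical point equations\<close>

text \<open>Moving a pole from \<open>\<zeta>\<close> to \<open>\<xi>\<close> changes the simple
  fraction by a function of small Lipschitz constant: an exact identity splits off both
  \<open>y - x\<close> and \<open>\<xi> - \<zeta>\<close>. The remaining two terms are at most
  \<open>4 / d ^ 3\<close> and \<open>2 / d ^ 3\<close>.\<close>

lemma norm_inverse_difference_perturb: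
  fixes x y \<xi> \<zeta> :: complex
  assumes d: "d > 0" "\<rho> \<le> d / 2" and \<xi>: "norm (\<xi> - \<zeta>) \<le> \<rho>" and x: "norm (x - \<zeta>) \<ge> d" and y: "norm (y - \<zeta>) \<ge> d"
  shows "norm ((1 / (x - \<xi>) - 1 / (y - \<xi>)) - (1 / (x - \<zeta>) - 1 / (y - \<zeta>))) \<le> norm (x - y) * (6 * \<rho> / d ^ 3)"
proof -
  have far: "norm (z - \<xi>) \<ge> d / 2" if "norm (z - \<zeta>) \<ge> d" for z
    using norm_triangle_ineq2[of "z - \<zeta>" "\<xi> - \<zeta>"] that \<xi> d by simp
  have x': "norm (x - \<xi>) \<ge> d / 2" and y': "norm (y - \<xi>) \<ge> d / 2" using far x y by auto
  have nz: "x - \<xi> \<noteq> 0" "y - \<xi> \<noteq> 0" "x - \<zeta> \<noteq> 0" "y - \<zeta> \<noteq> 0" using x y x' y' d(1) by auto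
  have alg: "(1 / a - 1 / b) - (1 / (a + w) - 1 / (b + w))
      = (b - a) * w * (1 / (a * b * (b + w)) + 1 / (a * (a + w) * (b + w)))"
    if "a \<noteq> 0" "b \<noteq> 0" "a + w \<noteq> 0" "b + w \<noteq> 0" for a b w :: complex
    using that by (simp add: divide_simps) algebra
  have "(1 / (x - \<xi>) - 1 / (y - \<xi>)) - (1 / (x - \<zeta>) - 1 / (y - \<zeta>))
      = (y - x) * (\<xi> - \<zeta>) * (1 / ((x - \<xi>) * (y - \<xi>) * (y - \<zeta>)) + 1 / ((x - \<xi>) * (x - \<zeta>) * (y - \<zeta>)))"
    using alg[of "x - \<xi>" "y - \<xi>" "\<xi> - \<zeta>"] nz by simp
  also have "norm \<dots> \<le> norm (x - y) * \<rho> * (1 / (d / 2 * (d / 2) * d) + 1 / (d / 2 * d * d))"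
    unfolding norm_mult
  proof (intro mult_mono)
    have inv: "norm (1 / (a * b * c)) \<le> 1 / (A * B * C)"
      if "A > 0" "B > 0" "C > 0" "A \<le> norm a" "B \<le> norm b" "C \<le> norm c" for a b c :: complex and A B C
    proof -
      have "A * B * C \<le> norm a * norm b * norm c" using that by (intro mult_mono) auto
      moreover have "A * B * C > 0" using that by simp
      ultimately show ?thesis unfolding norm_divide norm_mult norm_one by (intro frac_le) simp_all
    qed
    show "norm (1 / ((x - \<xi>) * (y - \<xi>) * (y - \<zeta>)) + 1 / ((x - \<xi>) * (x - \<zeta>) * (y - \<zeta>)))
       \<le> 1 / (d / 2 * (d / 2) * d) + 1 / (d / 2 * d * d)"
      by (rule order.trans[OF norm_triangle_ineq], rule add_mono; rule inv) (use d x y x' y' in simp_all)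
  qed (use \<xi> d order.trans[OF norm_ge_zero \<xi>] in \<open>auto simp: norm_minus_commute\<close>)
  also have "\<dots> = norm (x - y) * (6 * \<rho> / d ^ 3)"
    using d by (simp add: field_simps power3_eq_cube)
  finally show ?thesis .
qed

text \<open>A strictly concave function lies below its tangents, by the mean value theorem on either
  side of \<open>z\<close>.\<close>

lemma strictly_decreasing_deriv_tangent:
  fixes f f' :: "real \<Rightarrow> real"
  assumes deriv: "\<And>x. a < x \<Longrightarrow> x < b \<Longrightarrow> (f has_real_derivative f' x) (at x)"
    and decr: "\<And>x y. a < x \<Longrightarrow> x < y \<Longrightarrow> y < b \<Longrightarrow> f' y < f' x"
    and "a < z" "z < b" "a < u" "u < b" "u \<noteq> z"
  shows "f u - f z < f' z * (u - z)"
proof (cases "z < u")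
  case True
  then obtain c where c: "z < c" "c < u" "f u - f z = (u - z) * f' c"
    using MVT2[of z u f f'] deriv assms by (metis less_le_trans le_less_trans)
  have "f' c < f' z" using decr[of z c] c assms by simp
  then show ?thesis using c True by (simp add: mult.commute)
next
  case False
  then have "u < z" using assms by simp
  then obtain c where c: "u < c" "c < z" "f z - f u = (z - u) * f' c"
    using MVT2[of u z f f'] deriv assms by (metis less_le_trans le_less_trans)
  have "f' z < f' c" using decr[of c z] c assms by simp
  then have "(z - u) * f' z < (z - u) * f' c" using \<open>u < z\<close> by simp
  then show ?thesis using c by (simp add: algebra_simps)
qed

lemma finite_set_separation:
  fixes X :: "'a::metric_space set"
  assumes "finite X"
  obtains d where "d > 0" "\<And>x y. x \<in> X \<Longrightarrow> y \<in> X \<Longrightarrow> x \<noteq> y \<Longrightarrow> d \<le> dist x y"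
proof -
  define D where "D = (\<lambda>(x, y). dist x y) ` {(x, y) \<in> X \<times> X. x \<noteq> y}"
  have "finite {(x, y) \<in> X \<times> X. x \<noteq> y}"
    by (rule finite_subset[of _ "X \<times> X"]) (use assms in auto)
  then have D: "finite D" unfolding D_def by (rule finite_imageI)
  show ?thesis
  proof (rule that)
    \<comment> \<open>The element 1 provides a minimum when \<open>X\<close> has fewer than two
      points.\<close>
    show "Min (insert 1 D) > 0" using D by (auto simp: D_def)
    show "Min (insert 1 D) \<le> dist x y" if "x \<in> X" "y \<in> X" "x \<noteq> y" for x y
    proof (rule Min_le)
      have "dist x y \<in> D" unfolding D_def using that by (intro image_eqI[of _ _ "(x, y)"]) simp_all
      then show "dist x y \<in> insert 1 D" by simp
    qed (use D in simp)
  qed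
qed

text \<open>Stieltjes' argument: at a simple zero the term with \<open>p\<close> drops out of the
  differential equation, and with \<open>p = (x - z) F\<close> the quotient of second and first
  derivative is twice the logarithmic derivative of \<open>F\<close>, which splits into the
  exceptional factor and the other regular zeros.\<close>

lemma exceptional_jacobi_critical:
  fixes m \<alpha> \<beta> p
  defines "S \<equiv> xjacobi_S m \<alpha> \<beta>" and "E \<equiv> exceptional_factor p" and "Z \<equiv> regular_zeros p"
  assumes "p \<noteq> 0" and p: "exceptional_jacobi m n \<alpha> \<beta> p" and ord: "\<And>x. x \<in> Z \<Longrightarrow> order x p = 1"
    and z: "z \<in> Z" "poly S z \<noteq> 0" "poly E z \<noteq> 0"
  shows "(\<beta> + 1) / (1 + z) - (\<alpha> + 1) / (1 - z) + 2 * (poly (pderiv E) z / poly E z) - 2 * (poly (pderiv S) z / poly S z)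
      + 2 * (\<Sum>w\<in>Z - {z}. 1 / (z - w)) = 0"
proof -
  have Z: "finite Z" "Z \<subseteq> {-1<..<1}"
    using finite_subset[OF _ poly_roots_finite[OF \<open>p \<noteq> 0\<close>], of Z] by (auto simp: Z_def regular_zeros_def)
  have zI: "-1 < z" "z < 1" using z Z by auto
  define r where "r = (\<Prod>w\<in>Z - {z}. [:- w, 1:])"
  define F where "F = E * r"
  have "regular_factor p = (\<Prod>w\<in>Z. [:- w, 1:])"
    unfolding regular_factor_def Z_def[symmetric] using ord by (intro prod.cong) auto
  also have "\<dots> = [:- z, 1:] * r"
    unfolding r_def using Z(1) z(1) by (rule prod.remove)
  finally have pF: "p = [:- z, 1:] * F"
    using regular_exceptional_factorization[OF \<open>p \<noteq> 0\<close>] unfolding F_def E_def by (simp only: ac_simps)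
  have r0: "poly r z \<noteq> 0" using Z(1) by (auto simp: r_def poly_prod)
  have F: "poly F z \<noteq> 0" using r0 z by (simp add: F_def)
  have p0: "poly p z = 0" by (simp add: pF)
  have p1: "poly (pderiv p) z = poly F z" and p2: "poly (pderiv (pderiv p)) z = 2 * poly (pderiv F) z"
    unfolding pF by (simp_all add: pderiv_mult pderiv_add pderiv_pCons del: mult_pCons_left)
  have "poly (pderiv r) z = poly r z * (\<Sum>w\<in>Z - {z}. 1 / (z - w))"
    unfolding r_def using Z(1) by (intro poly_pderiv_prod_roots) auto
  then have F': "poly (pderiv F) z / poly F z = poly (pderiv E) z / poly E z + (\<Sum>w\<in>Z - {z}. 1 / (z - w))"
    using r0 z(3) by (simp add: F_def pderiv_mult add_divide_distrib)
  have "2 * poly (pderiv F) z + ((\<beta> - \<alpha> - (\<alpha> + \<beta> + 2) * z) / (1 - z\<^sup>2) - 2 * poly (pderiv S) z / poly S z) * poly F z = 0"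
    using p z(2) zI unfolding exceptional_jacobi_def Let_def S_def by (auto dest!: spec[of _ z] simp: p0 p1 p2)
  then have "2 * (poly (pderiv F) z / poly F z) + ((\<beta> - \<alpha> - (\<alpha> + \<beta> + 2) * z) / (1 - z\<^sup>2) - 2 * poly (pderiv S) z / poly S z) = 0"
    using F by (simp add: field_simps)
  moreover have "(\<beta> - \<alpha> - (\<alpha> + \<beta> + 2) * z) / (1 - z\<^sup>2) = (\<beta> + 1) / (1 + z) - (\<alpha> + 1) / (1 - z)"
  proof -
    have nz: "1 + z \<noteq> 0" "1 - z \<noteq> 0" using zI by auto
    have "(\<beta> + 1) / (1 + z) - (\<alpha> + 1) / (1 - z) = ((\<beta> + 1) * (1 - z) - (\<alpha> + 1) * (1 + z)) / ((1 + z) * (1 - z))"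
      by (rule diff_frac_eq[OF nz, THEN trans]) simp
    also have "(\<beta> + 1) * (1 - z) - (\<alpha> + 1) * (1 + z) = \<beta> - \<alpha> - (\<alpha> + \<beta> + 2) * z" by (simp add: algebra_simps)
    also have "(1 + z) * (1 - z) = 1 - z\<^sup>2" by (simp add: algebra_simps power2_eq_square)
    finally show ?thesis ..
  qed
  ultimately show ?thesis unfolding F' by simp
qed

section \<open>Log-concavity of the weight for large degree\<close>

theorem theorem5:
  fixes m :: nat and \<alpha> \<beta> :: real
  assumes "m \<ge> 1"
    and "\<alpha> > real m - 1"
    and "\<beta> > 0"
    and "\<alpha> + 1 - real m - \<beta> \<notin> real ` {0..m - 1}"
  shows "\<exists>n0. \<forall>n\<ge>n0. \<forall>p. exceptional_jacobi m n \<alpha> \<beta> p \<longrightarrow>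
           card (regular_zeros p) = n \<and>
           (\<forall>u. is_arg_max (energy_T (xjacobi_weight m \<alpha> \<beta> p) n)
                  (\<lambda>u. u \<in> {1..n} \<rightarrow> {-1<..<1}) u
                \<longleftrightarrow> u ` {1..n} = regular_zeros p)"
proof -
  define S where "S = xjacobi_S m \<alpha> \<beta>"
  define K where "K = complex_of_real ` {-1..1}"
  obtain X s where X: "finite X" "card X = m" "s \<noteq> 0" "X \<inter> K = {}"
    "cpoly S = smult s (\<Prod>\<zeta>\<in>X. [:- \<zeta>, 1:])"
    unfolding S_def K_def using xjacobi_S_roots[OF assms(2-4)] by metis
  have "compact K" unfolding K_def by (intro compact_continuous_image continuous_intros) simp
  obtain d where d: "d > 0" "\<And>x \<zeta>. x \<in> K \<Longrightarrow> \<zeta> \<in> X \<Longrightarrow> d \<le> dist x \<zeta>"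
    using separate_compact_closed[OF \<open>compact K\<close> finite_imp_closed[OF X(1)]] X(4) by blast
  obtain d' where d': "d' > 0" "\<And>x y. x \<in> X \<Longrightarrow> y \<in> X \<Longrightarrow> x \<noteq> y \<Longrightarrow> d' \<le> dist x y"
    using finite_set_separation[OF X(1)] by blast
  \<comment> \<open>The bounds keep the nearby zeros off \<open>[-1, 1]\<close>, make those
    belonging to different zeros of \<open>S\<close> distinct, and hold the Lipschitz constant of
    \<open>2 * H\<close> below at most \<open>1 / 8\<close>, half of the \<open>1 / 4\<close> that
    the factor \<open>(1 + x) powr (\<beta> + 1)\<close> supplies.\<close>
  define \<rho> where "\<rho> = Min {d / 2, d' / 2, d ^ 3 / (96 * real m)}"
  have \<rho>: "\<rho> > 0" "\<rho> \<le> d / 2" "\<rho> \<le> d' / 2" "\<rho> \<le> d ^ 3 / (96 * real m)"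
    using d(1) d'(1) assms(1) by (auto simp: \<rho>_def)
  have \<rho>m: "2 * (real m * (6 * \<rho> / d ^ 3)) \<le> 1 / 8"
    using \<rho>(4) d(1) assms(1) by (simp add: field_simps)
  have roots: "poly (cpoly S) \<zeta> = 0" if "\<zeta> \<in> X" for \<zeta>
    using that X(1) by (auto simp: X(5) poly_prod)
  have "\<forall>\<^sub>F n in sequentially. \<forall>p. exceptional_jacobi m n \<alpha> \<beta> p \<longrightarrow>
     (\<forall>\<zeta>\<in>X. \<exists>\<xi>. dist \<xi> \<zeta> < \<rho> \<and> poly (cpoly p) \<xi> = 0)"
    using eventually_exceptional_zeros_near[OF assms(1-3) \<rho>(1) X(1)] roots unfolding S_def by blast
  then obtain n0 where n0: "\<And>n p. n \<ge> n0 \<Longrightarrow> exceptional_jacobi m n \<alpha> \<beta> p \<Longrightarrow>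
     \<forall>\<zeta>\<in>X. \<exists>\<xi>. dist \<xi> \<zeta> < \<rho> \<and> poly (cpoly p) \<xi> = 0"
    unfolding eventually_sequentially by blast
  show ?thesis
  proof (intro exI[of _ n0] allI impI)
    fix n p assume n: "n0 \<le> n" and p: "exceptional_jacobi m n \<alpha> \<beta> p"
    have "p \<noteq> 0" using p assms(1) by (auto simp: exceptional_jacobi_def)
    from n0[OF n p] obtain \<xi> where \<xi>: "\<And>\<zeta>. \<zeta> \<in> X \<Longrightarrow> dist (\<xi> \<zeta>) \<zeta> < \<rho>" "\<And>\<zeta>. \<zeta> \<in> X \<Longrightarrow> poly (cpoly p) (\<xi> \<zeta>) = 0"
      by metis
    have inj: "inj_on \<xi> X"
    proof (rule inj_onI, rule ccontr)
      fix x y assume xy: "x \<in> X" "y \<in> X" "\<xi> x = \<xi> y" "x \<noteq> y"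
      have "dist x y \<le> dist (\<xi> x) x + dist (\<xi> x) y" by (rule dist_triangle3)
      then show False using \<xi>(1)[OF xy(1)] \<xi>(1)[OF xy(2)] xy d'(2)[of x y] \<rho>(3) by simp
    qed
    have \<xi>K: "\<xi> ` X \<inter> K = {}"
    proof -
      have "\<xi> \<zeta> \<notin> K" if "\<zeta> \<in> X" for \<zeta>
        using d(2)[of "\<xi> \<zeta>" \<zeta>] \<xi>(1)[OF that] that \<rho>(2) d(1) by force
      then show ?thesis by blast
    qed
    define Z where "Z = regular_zeros p"
    define E where "E = exceptional_factor p"
    obtain e where Z: "card Z = n" "\<And>x. x \<in> Z \<Longrightarrow> order x p = 1" and e: "e \<noteq> 0"
      "cpoly E = smult e (\<Prod>\<xi>\<in>\<xi> ` X. [:- \<xi>, 1:])"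
      unfolding Z_def E_def
    proof (rule exceptional_jacobi_zeros_structure[OF assms(1-3) p, of "\<xi> ` X"])
      show "card (\<xi> ` X) = m" using inj X(2) by (simp add: card_image)
    qed (use X(1) \<xi> \<xi>K in \<open>auto simp: K_def\<close>)
    have Z': "finite Z" "Z \<subseteq> {-1<..<1}"
      using finite_subset[OF _ poly_roots_finite[OF \<open>p \<noteq> 0\<close>], of Z] by (auto simp: Z_def regular_zeros_def)
    have S_log: "poly S x \<noteq> 0" "complex_of_real (poly (pderiv S) x / poly S x) = (\<Sum>\<zeta>\<in>X. 1 / (of_real x - \<zeta>))"
      if "-1 < x" "x < 1" for x
    proof -
      have "complex_of_real x \<notin> X" using X(4) that by (auto simp: K_def)
      from logderiv_real_poly[OF X(5,3,1) this]
      show "poly S x \<noteq> 0" "complex_of_real (poly (pderiv S) x / poly S x) = (\<Sum>\<zeta>\<in>X. 1 / (of_real x - \<zeta>))"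
        by blast+
    qed
    have E_log: "poly E x \<noteq> 0" "complex_of_real (poly (pderiv E) x / poly E x) = (\<Sum>\<zeta>\<in>X. 1 / (of_real x - \<xi> \<zeta>))"
      if "-1 < x" "x < 1" for x
    proof -
      have "complex_of_real x \<in> K" using that by (auto simp: K_def)
      then have "complex_of_real x \<notin> \<xi> ` X" using \<xi>K by blast
      from logderiv_real_poly[OF e(2,1) finite_imageI[OF X(1)] this]
      show "poly E x \<noteq> 0" "complex_of_real (poly (pderiv E) x / poly E x) = (\<Sum>\<zeta>\<in>X. 1 / (of_real x - \<xi> \<zeta>))"
        by (simp_all add: sum.reindex[OF inj])
    qed
    \<comment> \<open>Logarithmic derivative of \<open>E / S\<close>; the poles of its two parts are
      paired by \<open>\<xi>\<close>.\<close>
    define H where "H x = poly (pderiv E) x / poly E x - poly (pderiv S) x / poly S x" for x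
    have H: "\<bar>H x - H y\<bar> \<le> \<bar>x - y\<bar> * (real m * (6 * \<rho> / d ^ 3))" if "-1 < x" "x < 1" "-1 < y" "y < 1" for x y
    proof -
      have "complex_of_real (H x - H y) = (\<Sum>\<zeta>\<in>X. (1 / (of_real x - \<xi> \<zeta>) - 1 / (of_real y - \<xi> \<zeta>))
           - (1 / (of_real x - \<zeta>) - 1 / (of_real y - \<zeta>)))"
        unfolding H_def of_real_diff S_log(2)[OF that(1,2)] S_log(2)[OF that(3,4)]
          E_log(2)[OF that(1,2)] E_log(2)[OF that(3,4)] sum_subtractf by (simp add: algebra_simps)
      also have "norm \<dots> \<le> (\<Sum>\<zeta>\<in>X. norm (complex_of_real x - of_real y) * (6 * \<rho> / d ^ 3))"
      proof (rule sum_norm_le)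
        fix \<zeta> assume \<zeta>: "\<zeta> \<in> X"
        show "norm ((1 / (of_real x - \<xi> \<zeta>) - 1 / (of_real y - \<xi> \<zeta>)) - (1 / (of_real x - \<zeta>) - 1 / (of_real y - \<zeta>)))
           \<le> norm (complex_of_real x - of_real y) * (6 * \<rho> / d ^ 3)"
        proof (rule norm_inverse_difference_perturb[OF d(1) \<rho>(2)])
          show "norm (\<xi> \<zeta> - \<zeta>) \<le> \<rho>" using \<xi>(1)[OF \<zeta>] by (simp add: dist_norm)
          show "d \<le> norm (of_real x - \<zeta>)" "d \<le> norm (of_real y - \<zeta>)"
            using d(2)[of "of_real x" \<zeta>] d(2)[of "of_real y" \<zeta>] \<zeta> that by (auto simp: dist_norm K_def)
        qed
      qed
      also have "\<dots> = \<bar>x - y\<bar> * (real m * (6 * \<rho> / d ^ 3))"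
        using X(2) by (simp flip: of_real_diff)
      finally show ?thesis by (simp only: norm_of_real)
    qed
    define L where "L x = (\<alpha> + 1) * ln (1 - x) + (\<beta> + 1) * ln (1 + x) + ln ((poly E x)\<^sup>2) - ln ((poly S x)\<^sup>2)" for x
    define L' where "L' x = (\<beta> + 1) / (1 + x) - (\<alpha> + 1) / (1 - x) + 2 * (poly (pderiv E) x / poly E x)
        - 2 * (poly (pderiv S) x / poly S x)" for x
    have deriv: "(L has_real_derivative L' x) (at x)" if "-1 < x" "x < 1" for x
    proof -
      have ln_sq: "((\<lambda>x. ln ((poly f x)\<^sup>2)) has_real_derivative 2 * (poly (pderiv f) x / poly f x)) (at x)"
        if "poly f x \<noteq> 0" for f :: "real poly"
      proof -
        have sq: "((\<lambda>x. (poly f x)\<^sup>2) has_real_derivative 2 * poly f x * poly (pderiv f) x) (at x)"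
          by (auto intro!: derivative_eq_intros poly_DERIV)
        have pos: "(poly f x)\<^sup>2 > 0" using that by simp
        show ?thesis
          by (rule DERIV_cong[OF DERIV_chain2[OF DERIV_ln_divide[OF pos] sq]])
             (use that in \<open>simp add: field_simps power2_eq_square\<close>)
      qed
      have a: "((\<lambda>x. (\<alpha> + 1) * ln (1 - x)) has_real_derivative - ((\<alpha> + 1) / (1 - x))) (at x)"
        and b: "((\<lambda>x. (\<beta> + 1) * ln (1 + x)) has_real_derivative (\<beta> + 1) / (1 + x)) (at x)"
        using that by (auto intro!: derivative_eq_intros)
      show ?thesis unfolding L_def L'_def
        by (rule DERIV_cong[OF DERIV_diff[OF DERIV_add[OF DERIV_add[OF a b] ln_sq[OF E_log(1)[OF that]]] ln_sq[OF S_log(1)[OF that]]]])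
           simp
    qed
    \<comment> \<open>The term in \<open>\<beta>\<close> drops by at least
      \<open>(y - x) / 4\<close> because \<open>(1 + x) * (1 + y) \<le> 4\<close>, the term in
      \<open>\<alpha>\<close> does not increase, and \<open>2 * H\<close> can offset at most
      \<open>(y - x) / 8\<close>.\<close>
    have decr: "L' y < L' x" if "-1 < x" "x < y" "y < 1" for x y
    proof -
      have 1: "(\<beta> + 1) / (1 + x) - (\<beta> + 1) / (1 + y) \<ge> (y - x) / 4"
      proof -
        have "(1 + x) * (1 + y) \<le> 2 * 2" using that by (intro mult_mono) auto
        then have "(y - x) / 4 \<le> ((\<beta> + 1) * (y - x)) / ((1 + x) * (1 + y))"
          using that assms(3) by (intro frac_le) auto
        also have "\<dots> = (\<beta> + 1) / (1 + x) - (\<beta> + 1) / (1 + y)"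
          using that by (simp add: diff_frac_eq algebra_simps)
        finally show ?thesis .
      qed
      have 2: "(\<alpha> + 1) / (1 - x) \<le> (\<alpha> + 1) / (1 - y)"
        using that assms(1,2) by (intro divide_left_mono) auto
      have "2 * \<bar>H x - H y\<bar> \<le> \<bar>x - y\<bar> * (2 * (real m * (6 * \<rho> / d ^ 3)))"
        using mult_left_mono[OF H[of x y], of 2] that by (simp only: mult.left_commute)
      also have "\<dots> \<le> \<bar>x - y\<bar> * (1 / 8)" using \<rho>m by (intro mult_left_mono) auto
      also have "\<dots> < (y - x) / 4" using that by simp
      finally have 3: "2 * (H y - H x) < (y - x) / 4"
        using abs_ge_minus_self[of "H x - H y"] by argo
      have "L' x - L' y = ((\<beta> + 1) / (1 + x) - (\<beta> + 1) / (1 + y)) + ((\<alpha> + 1) / (1 - y) - (\<alpha> + 1) / (1 - x)) - 2 * (H y - H x)"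
        unfolding L'_def H_def by simp
      then show ?thesis using 1 2 3 by linarith
    qed
    define v where "v = xjacobi_weight m \<alpha> \<beta> p"
    have v: "v x > 0" "ln (v x) = L x" if "x \<in> {-1<..<1}" for x
    proof -
      have x: "-1 < x" "x < 1" using that by auto
      note nz = S_log(1)[OF x] E_log(1)[OF x]
      have vx: "v x = (1 - x) powr (\<alpha> + 1) * (1 + x) powr (\<beta> + 1) * (poly E x)\<^sup>2 / (poly S x)\<^sup>2"
        by (simp add: v_def xjacobi_weight_def E_def S_def)
      show "v x > 0" unfolding vx using nz x by simp
      show "ln (v x) = L x" unfolding vx L_def using nz x by (simp add: ln_mult ln_div ln_powr)
    qed
    have "is_arg_max (energy_T v (card Z)) (\<lambda>u. u \<in> {1..card Z} \<rightarrow> {-1<..<1}) u \<longleftrightarrow> u ` {1..card Z} = Z" for u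
    proof (rule is_arg_max_energy_T[where d = L'])
      show "v z > 0" if "z \<in> {-1<..<1}" for z using v(1)[OF that] .
      show "ln (v u) - ln (v z) < L' z * (u - z)" if "z \<in> Z" "u \<in> {-1<..<1}" "u \<noteq> z" for z u
      proof -
        have z: "z \<in> {-1<..<1}" using that Z' by blast
        show ?thesis unfolding v(2)[OF z] v(2)[OF that(2)]
          using z that by (intro strictly_decreasing_deriv_tangent[of "-1" 1 L L'] deriv decr) auto
      qed
      show "L' z + 2 * (\<Sum>w\<in>Z - {z}. 1 / (z - w)) = 0" if "z \<in> Z" for z
      proof -
        have z: "-1 < z" "z < 1" using that Z' by auto
        show ?thesis unfolding L'_def
          using exceptional_jacobi_critical[OF \<open>p \<noteq> 0\<close> p Z(2)[unfolded Z_def]] that S_log(1)[OF z] E_log(1)[OF z]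
          unfolding Z_def S_def E_def by blast
      qed
    qed (use Z' in auto)
    then show "card (regular_zeros p) = n \<and>
           (\<forall>u. is_arg_max (energy_T (xjacobi_weight m \<alpha> \<beta> p) n)
                  (\<lambda>u. u \<in> {1..n} \<rightarrow> {-1<..<1}) u
                \<longleftrightarrow> u ` {1..n} = regular_zeros p)"
      using Z(1) unfolding v_def Z_def by simp
  qed
qed

end
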